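(* Let $\varepsilon>0$. Suppose that $\mathscr{A}$ is a set of positive integers and that, for each prime $p \leq X^{1/2}$, the set $\mathscr{A} \bmod p$ lies in some arithmetic progression $S_p \subset \mathbb{Z}/p\mathbb{Z}$ of length $(1-\varepsilon)p$. Then $|\mathscr{A}[X]| \ll_{\varepsilon} X^{1/2-\varepsilon'}$, where $\varepsilon'>0$ depends on $\varepsilon$ only.
   Context: An arithmetic progression in $\mathbb{Z}/p\mathbb{Z}$ of length $L$ is a set $\{a, a+d, \dots, a+(L-1)d\}$ with $d \neq 0$ (the common difference may depend on $p$). $\mathscr{A}[X] := \mathscr{A}\cap\{1,\dots,X\}$. *)

theory Defs
  imports Complex_Main "HOL-Number_Theory.Number_Theory"
begin

text \<open>Residue classes modulo \<open>p\<close> are represented by their canonical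
  representatives in \<open>{0..<int p}\<close>; subsets of \<open>\<int>/p\<int>\<close> are sets of such representatives.\<close>

definition residues_mod :: "nat set \<Rightarrow> nat \<Rightarrow> int set" where
  "residues_mod A p = (\<lambda>n. int n mod int p) ` A"

definition is_AP_mod :: "nat \<Rightarrow> nat \<Rightarrow> int set \<Rightarrow> bool" where
  "is_AP_mod p L S \<longleftrightarrow>
     (\<exists>a d. \<not> [d = 0] (mod int p) \<and> S = (\<lambda>j. (a + int j * d) mod int p) ` {..<L})"

definition initial_part :: "nat set \<Rightarrow> real \<Rightarrow> nat set" where
  "initial_part A X = A \<inter> {1..nat \<lfloor>X\<rfloor>}"

end

theory Submission
  imports Defs "HOL-Analysis.Harmonic_Numbers" "HOL-Real_Asymp.Real_Asymp"
begin

text \<open>Suppose a subset \<open>B\<close> of \<open>{1..N}\<close> has about \<open>N\<^sup>1\<^sup>/\<^sup>2\<close> elements, up to a factor \<open>N\<^sup>c\<close> with tiny \<open>c\<close>.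

  For each prime \<open>p \<le> N\<^sup>1\<^sup>/\<^sup>2\<close>, being confined to a progression forces large Fourier coefficients of \<open>B\<close>
  at some fractions \<open>b/p\<close>. By the large sieve, applied to the representation function of \<open>B - B\<close>,
  the additive energy of \<open>B\<close> is then almost maximal. Hence there are many \<open>h\<close> for which
  \<open>A = B \<inter> (B + h)\<close> has at least \<open>N\<^sup>1\<^sup>/\<^sup>2\<^sup>-\<^sup>c\<close> elements, and for random \<open>n\<^sub>1, \<dots>, n\<^sub>k \<in> A\<close> the set \<open>W\<close> of
  all \<open>h\<close> with \<open>n\<^sub>i - h \<in> B\<close> for every \<open>i\<close> is typically just as large.

  By Gallagher's larger sieve, a set with at least \<open>N\<^sup>1\<^sup>/\<^sup>2\<^sup>-\<^sup>c\<close> elements occupies on average almost half of the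
  residues modulo \<open>p\<close>, in a robust (collision) sense. The residues of \<open>W\<close> avoid, up to dilation, the
  gap of length at least \<open>\<epsilon> p\<close> of the progression translated by each \<open>n\<^sub>i\<close>. Since \<open>A\<close> has almost half of the
  residues, \<open>k\<close> random translates of the gap cover a proportion of about \<open>1/2 + \<epsilon>\<close>, so \<open>W\<close> would occupy
  less than half of the residues, a contradiction.\<close>

section \<open>Lower bounds of Chebyshev and Mertens type for the primes\<close>

section \<open>Primes\<close>

text \<open>In the induction step, \<open>Suc n div d\<close> exceeds \<open>n div d\<close> exactly
  at the divisors \<open>d\<close> of \<open>Suc n\<close>, and the von Mangoldt values at these add
  up to \<open>ln (Suc n)\<close>.\<close>

lemma ln_fact_eq_sum_mangoldt:
  "ln (fact n :: real) = (\<Sum>d=1..n. mangoldt d * real (n div d))"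
proof (induction n)
  case (Suc n)
  have div: "Suc n div d = n div d + (if d dvd Suc n then 1 else 0)" if "d \<in> {1..Suc n}" for d
    using that by (simp add: div_Suc dvd_eq_mod_eq_0)
  have "(\<Sum>d=1..Suc n. mangoldt d * real (Suc n div d)) =
        (\<Sum>d=1..Suc n. mangoldt d * real (n div d)) + (\<Sum>d=1..Suc n. if d dvd Suc n then mangoldt d else 0)"
    unfolding sum.distrib [symmetric] by (rule sum.cong) (auto simp: div algebra_simps)
  also have "(\<Sum>d=1..Suc n. if d dvd Suc n then mangoldt d else 0) = (\<Sum>d | d dvd Suc n. mangoldt d :: real)"
    by (rule sum.mono_neutral_cong_right) (auto simp: Suc_le_eq dest: dvd_imp_le dvd_pos_nat [rotated])
  also have "\<dots> = ln (real (Suc n))"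
    using mangoldt_sum [where ?'a = real, of "Suc n"] by simp
  also have "(\<Sum>d=1..Suc n. mangoldt d * real (n div d)) = ln (fact n :: real)"
    by (simp add: Suc.IH)
  finally show ?case
    by (simp add: ln_mult)
qed simp

text \<open>Each prime power is \<open>p ^ Suc k\<close> for exactly one pair, so von Mangoldt sums
  can be regrouped by primes. With \<open>g d = n / d\<close> this serves the Mertens bound, with
  \<open>g d = 1\<close> the Chebyshev bound.\<close>

lemma sum_mangoldt_mult:
  fixes g :: "nat \<Rightarrow> real"
  shows "(\<Sum>d=1..n. mangoldt d * g d) =
    (\<Sum>p | prime p \<and> p \<le> n. ln (real p) * (\<Sum>k | p ^ Suc k \<le> n. g (p ^ Suc k)))"
proof -
  define D where "D = {d\<in>{1..n}. primepow d}"
  define I where "I = (SIGMA p:{p. prime p \<and> p \<le> n}. {k. p ^ Suc k \<le> n})"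
  have fin: "finite {k. p ^ Suc k \<le> n}" if "prime p" for p
  proof (rule finite_subset)
    show "{k. p ^ Suc k \<le> n} \<subseteq> {..n}"
    proof clarify
      fix k assume "p ^ Suc k \<le> n"
      moreover have "k < p ^ k" using prime_gt_1_nat[OF that] by (intro power_gt_expt) simp
      moreover have "p ^ k \<le> p ^ Suc k" using prime_gt_1_nat[OF that] by simp
      ultimately show "k \<le> n" by linarith
    qed
  qed simp
  have bij: "bij_betw (\<lambda>(p, k). p ^ Suc k) (Collect prime \<times> UNIV) (Collect (primepow :: nat \<Rightarrow> bool))"
    by (rule bij_betw_primepows)
  have "bij_betw (\<lambda>(p, k). p ^ Suc k) I D"
  proof (rule bij_betw_subset [OF bij])
    show "I \<subseteq> Collect prime \<times> UNIV" by (auto simp: I_def)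
    show "(\<lambda>(p, k). p ^ Suc k) ` I = D"
    proof (intro equalityI subsetI)
      fix d assume "d \<in> (\<lambda>(p, k). p ^ Suc k) ` I"
      then obtain p k where "prime p" "p ^ Suc k \<le> n" "d = p ^ Suc k"
        by (auto simp: I_def)
      then show "d \<in> D"
        using prime_gt_0_nat[of p] by (auto simp: D_def Suc_le_eq simp del: power_Suc)
    next
      fix d assume d: "d \<in> D"
      then obtain p k where pk: "prime p" "d = p ^ Suc k"
        using bij by (auto simp: D_def bij_betw_def image_iff elim!: equalityE)
      have "p \<le> p ^ Suc k" using prime_gt_0_nat[OF pk(1)] by simp
      then have "(p, k) \<in> I"
        using d pk by (auto simp: I_def D_def simp del: power_Suc)
      then show "d \<in> (\<lambda>(p, k). p ^ Suc k) ` I"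
        using pk by (intro image_eqI[of _ _ "(p, k)"]) simp_all
    qed
  qed
  have "(\<Sum>d=1..n. mangoldt d * g d) = (\<Sum>d\<in>D. mangoldt d * g d)"
    by (rule sum.mono_neutral_right) (auto simp: D_def mangoldt_def)
  also have "\<dots> = (\<Sum>(p, k)\<in>I. mangoldt (p ^ Suc k) * g (p ^ Suc k))"
    using \<open>bij_betw _ I D\<close> by (subst sum.reindex_bij_betw [symmetric]) (auto simp: case_prod_unfold)
  also have "\<dots> = (\<Sum>(p, k)\<in>I. ln (real p) * g (p ^ Suc k))"
    by (rule sum.cong) (auto simp: I_def simp del: power_Suc)
  also have "\<dots> = (\<Sum>p | prime p \<and> p \<le> n. \<Sum>k | p ^ Suc k \<le> n. ln (real p) * g (p ^ Suc k))"
    unfolding I_def by (subst sum.Sigma) (auto simp: fin simp del: power_Suc)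
  finally show ?thesis
    by (simp add: sum_distrib_left)
qed

lemma ln_fact_ge: "real n * ln (real n) - real n \<le> ln (fact n :: real)"
proof (induction n)
  case (Suc n)
  show ?case
  proof (cases "n = 0")
    case False
    have "ln (real (Suc n)) - ln (real n) = ln (real (Suc n) / real n)"
      using False by (simp add: ln_div)
    also have "\<dots> \<le> real (Suc n) / real n - 1"
      using False by (intro ln_le_minus_one) auto
    also have "\<dots> = 1 / real n"
      using False by (simp add: field_simps)
    finally have "real n * (ln (real (Suc n)) - ln (real n)) \<le> 1"
      using False by (simp add: field_simps)
    moreover have "ln (fact (Suc n) :: real) = ln (real (Suc n)) + ln (fact n)"
      unfolding fact_Suc by (subst ln_mult) auto
    ultimately show ?thesis
      using Suc.IH by (simp add: algebra_simps del: fact_Suc)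
  qed simp
qed simp

text \<open>Dropping the floors in the expansion of \<open>ln (fact n)\<close> leaves for each prime
  a geometric series over its powers, whence \<open>1 / (p - 1)\<close>. The weak Stirling bound
  \<open>ln_fact_ge\<close> supplies the lower estimate.\<close>

lemma sum_ln_prime_ge:
  assumes "n \<ge> 1"
  shows "ln (real n) - 1 \<le> (\<Sum>p | prime p \<and> p \<le> n. ln (real p) / (real p - 1))"
proof -
  have geom: "(\<Sum>k | p ^ Suc k \<le> n. real n / real (p ^ Suc k)) \<le> real n / (real p - 1)"
    if "prime p" for p
  proof -
    have p: "real p > 1" using prime_gt_1_nat[OF that] by simp
    have sums: "(\<lambda>k. (1 / real p) ^ Suc k) sums (1 / (real p - 1))"
    proof -
      have "(\<lambda>k. (1 / real p) * (1 / real p) ^ k) sums ((1 / real p) * (1 / (1 - 1 / real p)))"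
        using p by (intro sums_mult geometric_sums) auto
      then show ?thesis using p by (simp add: field_simps)
    qed
    have "(\<Sum>k | p ^ Suc k \<le> n. (1 / real p) ^ Suc k) \<le> 1 / (real p - 1)"
    proof (cases "finite {k. p ^ Suc k \<le> n}")
      case True
      then show ?thesis
        using sums sums_unique[OF sums] p
        by (metis (no_types, lifting) sum_le_suminf sums_summable zero_le_divide_1_iff zero_le_power of_nat_0_le_iff)
    qed (use p in auto)
    then have "real n * (\<Sum>k | p ^ Suc k \<le> n. (1 / real p) ^ Suc k) \<le> real n * (1 / (real p - 1))"
      by (intro mult_left_mono) auto
    then show ?thesis
      by (simp add: sum_distrib_left power_one_over)
  qed
  have "real n * ln (real n) - real n \<le> ln (fact n :: real)"
    by (rule ln_fact_ge)
  also have "\<dots> = (\<Sum>d=1..n. mangoldt d * real (n div d))"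
    by (rule ln_fact_eq_sum_mangoldt)
  also have "\<dots> \<le> (\<Sum>d=1..n. mangoldt d * (real n / real d))"
    by (intro sum_mono mult_left_mono of_nat_div_le_of_nat mangoldt_nonneg)
  also have "\<dots> = (\<Sum>p | prime p \<and> p \<le> n. ln (real p) * (\<Sum>k | p ^ Suc k \<le> n. real n / real (p ^ Suc k)))"
    by (rule sum_mangoldt_mult)
  also have "\<dots> \<le> (\<Sum>p | prime p \<and> p \<le> n. ln (real p) * (real n / (real p - 1)))"
    by (intro sum_mono mult_left_mono geom) (auto dest: prime_ge_1_nat)
  also have "\<dots> = real n * (\<Sum>p | prime p \<and> p \<le> n. ln (real p) / (real p - 1))"
    by (simp add: sum_distrib_left mult_ac)
  finally have "real n * (ln (real n) - 1) \<le> real n * (\<Sum>p | prime p \<and> p \<le> n. ln (real p) / (real p - 1))"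
    by (simp add: algebra_simps)
  then show ?thesis
    using assms by simp
qed

text \<open>Chebyshev's argument: the central binomial coefficient of \<open>2 * m\<close> is at
  least \<open>4 ^ m / (2 * m)\<close>, while its logarithm is at most the sum of
  \<open>mangoldt\<close> up to \<open>n\<close>, to which each prime contributes at most
  \<open>ln n\<close>.\<close>

lemma prime_count_ge:
  assumes "n \<ge> 2"
  shows "(real n - 1) / 2 - ln (real n) \<le> real (card {p. prime p \<and> p \<le> n}) * ln (real n)"
proof -
  define m where "m = n div 2"
  have m: "m \<ge> 1" "2 * m \<le> n" "n \<le> 2 * m + 1"
    using assms by (auto simp: m_def)
  have count: "real (card {k. p ^ Suc k \<le> n}) * ln (real p) \<le> ln (real n)" if "prime p" for p
  proof -
    have p: "p > 1" using prime_gt_1_nat[OF that] .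
    define K where "K = nat \<lfloor>log (real p) (real n)\<rfloor>"
    have "{k. p ^ Suc k \<le> n} \<subseteq> {..<K}"
    proof (intro subsetI)
      fix k assume "k \<in> {k. p ^ Suc k \<le> n}"
      then have "p ^ Suc k \<le> n" by blast
      then have "real p ^ Suc k \<le> real n" by (metis of_nat_le_iff of_nat_power)
      then have "real (Suc k) \<le> log (real p) (real n)"
        using p assms by (subst le_log_iff) (auto simp: powr_realpow simp del: power_Suc of_nat_Suc)
      then show "k \<in> {..<K}" by (simp add: K_def Suc_le_eq[symmetric] le_nat_iff le_floor_iff)
    qed
    then have "card {k. p ^ Suc k \<le> n} \<le> K"
      using card_mono[of "{..<K}"] by fastforce
    also have "real K \<le> log (real p) (real n)"
      using p assms by (simp add: K_def)
    finally have "real (card {k. p ^ Suc k \<le> n}) \<le> log (real p) (real n)" by simp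
    then show ?thesis
      using p by (simp add: log_def field_simps)
  qed
  have mono: "(\<Sum>d=1..2*m. f d) \<le> (\<Sum>d=1..n. f d)" if "\<And>d. f d \<ge> 0" for f :: "nat \<Rightarrow> real"
    using m that by (intro sum_mono2) auto
  have "(real n - 1) / 2 - ln (real n) \<le> real m * ln 4 - ln (real (2 * m))"
  proof -
    have "(1::real) \<le> ln 4" using exp_le by (subst ln_ge_iff) auto
    then have "real m * 1 \<le> real m * ln 4" by (intro mult_left_mono) auto
    moreover have "real n \<le> 2 * real m + 1" using m by linarith
    moreover have "ln (real (2 * m)) \<le> ln (real n)" using m by (subst ln_le_cancel_iff) auto
    ultimately show ?thesis by argo
  qed
  also have "real m * ln 4 - ln (real (2 * m)) = ln (4 ^ m / real (2 * m))"
    using m by (subst ln_div) (auto simp: ln_realpow)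
  also have "\<dots> \<le> ln (real (2 * m choose m))"
  proof (rule ln_mono)
    show "4 ^ m / real (2 * m) \<le> real (2 * m choose m)"
      using central_binomial_lower_bound[of m] m by simp
  qed (use m in auto)
  also have "\<dots> = ln (fact (2 * m)) - 2 * ln (fact m :: real)"
  proof -
    have "real (2 * m choose m) = fact (2 * m) / (fact m * fact m)"
      using binomial_fact[of m "2 * m", where ?'a = real] by (simp add: mult_2)
    then show ?thesis by (simp add: ln_div ln_mult)
  qed
  also have "\<dots> = (\<Sum>d=1..2*m. mangoldt d * (real (2 * m div d) - 2 * real (m div d)))"
  proof -
    have "ln (fact m :: real) = (\<Sum>d=1..2*m. mangoldt d * real (m div d))"
      unfolding ln_fact_eq_sum_mangoldt by (rule sum.mono_neutral_left) auto
    then show ?thesis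
      by (simp only: ln_fact_eq_sum_mangoldt[of "2 * m"] sum_distrib_left sum_subtractf[symmetric])
        (rule sum.cong, auto simp: algebra_simps)
  qed
  also have "\<dots> \<le> (\<Sum>d=1..2*m. mangoldt d * 1)"
  proof (intro sum_mono mult_left_mono mangoldt_nonneg)
    fix d assume "d \<in> {1..2*m}"
    have "2 * m div d \<le> 2 * (m div d) + 1"
    proof -
      have "m < d * (m div d + 1)" using \<open>d \<in> _\<close> by (simp add: dividend_less_times_div)
      then have "2 * m < (2 * (m div d) + 2) * d" by (simp add: algebra_simps)
      then have "2 * m div d < 2 * (m div d) + 2" by (rule less_mult_imp_div_less)
      then show ?thesis by simp
    qed
    then show "real (2 * m div d) - 2 * real (m div d) \<le> 1" by linarith
  qed
  also have "\<dots> \<le> (\<Sum>d=1..n. mangoldt d * 1)"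
    by (rule mono) (simp add: mangoldt_nonneg)
  also have "\<dots> = (\<Sum>p | prime p \<and> p \<le> n. ln (real p) * (\<Sum>k | p ^ Suc k \<le> n. 1))"
    by (rule sum_mangoldt_mult)
  also have "\<dots> \<le> (\<Sum>p | prime p \<and> p \<le> n. ln (real n))"
    using count by (intro sum_mono) (simp add: mult.commute)
  finally show ?thesis
    by simp
qed

lemma eventually_prime_count_ge:
  assumes "\<delta> > 0"
  shows "eventually (\<lambda>n. real n powr (1 - \<delta>) \<le> real (card {p. prime p \<and> p \<le> n})) at_top"
proof -
  have "eventually (\<lambda>n::nat. real n powr (1 - \<delta>) \<le> ((real n - 1) / 2 - ln (real n)) / ln (real n)) at_top"
    using assms by real_asymp
  then show ?thesis
    using eventually_ge_at_top[of 2]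
  proof eventually_elim
    case (elim n)
    have "((real n - 1) / 2 - ln (real n)) / ln (real n) \<le> real (card {p. prime p \<and> p \<le> n})"
      using prime_count_ge[OF elim(2)] elim(2) by (subst pos_divide_le_eq) auto
    with elim show ?case by linarith
  qed
qed

text \<open>The primes up to \<open>q\<close> cost only the constant \<open>C\<close>; beyond
  \<open>2 / \<delta>\<close>, replacing \<open>p - 1\<close> by \<open>p\<close> costs a factor
  \<open>1 - \<delta> / 2\<close>. The other half of \<open>\<delta>\<close> absorbs the
  constants.\<close>

lemma eventually_sum_ln_prime_over_prime_ge:
  assumes "\<delta> > 0"
  shows "eventually (\<lambda>n. (1 - \<delta>) * ln (real n) \<le> (\<Sum>p | prime p \<and> p0 \<le> p \<and> p \<le> n. ln (real p) / real p)) at_top"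
proof -
  define q where "q = max p0 (nat \<lceil>2 / \<delta>\<rceil> + 2)"
  define C where "C = (\<Sum>p | prime p \<and> p \<le> q. ln (real p) / (real p - 1))"
  have "eventually (\<lambda>n::nat. (1 - \<delta>) * ln (real n) \<le> (1 - \<delta> / 2) * (ln (real n) - 1 - C)) at_top"
    using assms by real_asymp
  then show ?thesis
    using eventually_ge_at_top[of 1] eventually_ge_at_top[of q]
  proof eventually_elim
    case (elim n)
    have q: "real q \<ge> 2 / \<delta>" "q \<ge> 2" "q \<ge> p0" by (auto simp: q_def) linarith
    have nonneg: "0 \<le> ln (real p) / real p" if "prime p" for p
      using prime_ge_1_nat[OF that] by simp
    have big: "(1 - \<delta> / 2) * (ln (real p) / (real p - 1)) \<le> ln (real p) / real p" if "prime p" "q < p" for p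
    proof -
      have p: "real p > 2 / \<delta>" "real p > 1" using that q prime_gt_1_nat[of p] by auto
      then have "(1 - \<delta> / 2) * real p \<le> real p - 1" using assms by (simp add: field_simps)
      then have "(1 - \<delta> / 2) / (real p - 1) \<le> 1 / real p"
        using p by (simp add: field_simps)
      then have "ln (real p) * ((1 - \<delta> / 2) / (real p - 1)) \<le> ln (real p) * (1 / real p)"
        using p by (intro mult_left_mono) auto
      then show ?thesis by (simp add: mult_ac)
    qed
    show ?case
    \<comment> \<open>Multiplying by \<open>1 - \<delta> / 2\<close> needs this factor to be
      nonnegative; for larger \<open>\<delta>\<close> the left side is not positive.\<close>
    proof (cases "\<delta> \<le> 2")
      case True
      have "{p. prime p \<and> p \<le> n} = {p. prime p \<and> p \<le> q} \<union> {p. prime p \<and> q < p \<and> p \<le> n}"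
        using elim by auto
      then have "(\<Sum>p | prime p \<and> p \<le> n. ln (real p) / (real p - 1)) =
          C + (\<Sum>p | prime p \<and> q < p \<and> p \<le> n. ln (real p) / (real p - 1))"
        unfolding C_def by (simp only:) (rule sum.union_disjoint, auto)
      then have "ln (real n) - 1 - C \<le> (\<Sum>p | prime p \<and> q < p \<and> p \<le> n. ln (real p) / (real p - 1))"
        using sum_ln_prime_ge[OF elim(2)] by linarith
      then have "(1 - \<delta> / 2) * (ln (real n) - 1 - C) \<le>
          (1 - \<delta> / 2) * (\<Sum>p | prime p \<and> q < p \<and> p \<le> n. ln (real p) / (real p - 1))"
        using True by (intro mult_left_mono) auto
      also have "\<dots> \<le> (\<Sum>p | prime p \<and> q < p \<and> p \<le> n. ln (real p) / real p)"
        unfolding sum_distrib_left by (intro sum_mono big) auto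
      also have "\<dots> \<le> (\<Sum>p | prime p \<and> p0 \<le> p \<and> p \<le> n. ln (real p) / real p)"
        using q nonneg by (intro sum_mono2) auto
      finally show ?thesis using elim(1) by linarith
    next
      case False
      then have "(1 - \<delta>) * ln (real n) \<le> 0"
        using elim by (intro mult_nonpos_nonneg) auto
      also have "\<dots> \<le> (\<Sum>p | prime p \<and> p0 \<le> p \<and> p \<le> n. ln (real p) / real p)"
        using nonneg by (intro sum_nonneg) auto
      finally show ?thesis .
    qed
  qed
qed

section \<open>Geometric exponential sums and the dual large sieve\<close>

section \<open>The large sieve\<close>

definition e2pi :: "real \<Rightarrow> complex" where
  "e2pi x = cis (2 * pi * x)"

lemma norm_e2pi [simp]: "norm (e2pi x) = 1"
  by (simp add: e2pi_def)

lemma e2pi_0 [simp]: "e2pi 0 = 1"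
  by (simp add: e2pi_def)

lemma e2pi_add: "e2pi (x + y) = e2pi x * e2pi y"
  by (simp add: e2pi_def cis_mult algebra_simps)

lemma e2pi_uminus: "e2pi (- x) = cnj (e2pi x)"
  by (simp add: e2pi_def cis_cnj)

lemma e2pi_of_int [simp]: "e2pi (of_int k) = 1"
  by (simp add: e2pi_def cis_multiple_2pi)

lemma e2pi_cong: "x - y \<in> \<int> \<Longrightarrow> e2pi x = e2pi y"
  by (metis Ints_cases e2pi_add e2pi_of_int diff_add_cancel mult_1)

lemma e2pi_of_nat_mult: "e2pi (real n * x) = e2pi x ^ n"
  unfolding e2pi_def Complex.DeMoivre by (rule arg_cong [of _ _ cis]) simp

text \<open>Jordan's inequality: the chords of \<open>sin\<close> over \<open>[0, x]\<close> and
  \<open>[x, pi / 2]\<close> have slopes \<open>cos u\<close> and \<open>cos v\<close> with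
  \<open>u < v\<close>, and \<open>cos\<close> decreases.\<close>

lemma sin_ge_two_over_pi:
  assumes "0 \<le> x" "x \<le> pi / 2"
  shows "2 / pi * x \<le> sin x"
proof (cases "x = 0 \<or> x = pi / 2")
  case True
  then show ?thesis
  proof
    assume x: "x = pi / 2"
    show ?thesis unfolding x by simp
  qed simp
next
  case False
  then have x: "0 < x" "x < pi / 2" using assms by auto
  obtain u where u: "0 < u" "u < x" "sin x - sin 0 = (x - 0) * cos u"
    using MVT2[OF x(1), of sin cos] by (auto intro: DERIV_sin)
  obtain v where v: "x < v" "v < pi / 2" "sin (pi / 2) - sin x = (pi / 2 - x) * cos v"
    using MVT2[OF x(2), of sin cos] by (auto intro: DERIV_sin)
  have "cos v \<le> cos u"
    using u v by (intro cos_monotone_0_pi_le) auto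
  then have "x * ((pi / 2 - x) * cos v) \<le> x * ((pi / 2 - x) * cos u)"
    using x by (intro mult_left_mono) auto
  also have "\<dots> = (pi / 2 - x) * sin x"
    using u by simp
  also have "(pi / 2 - x) * cos v = 1 - sin x"
    using v by simp
  finally have "x \<le> pi / 2 * sin x"
    by (simp add: algebra_simps)
  then show ?thesis
    by (simp add: field_simps)
qed

text \<open>This majorant of \<open>1 / (2 * min x (1 - x))\<close> is a sum rather than a maximum,
  so that sums over frequencies split into two halves exchanged by the reflection of
  \<open>x\<close> to \<open>1 - x\<close>.\<close>

definition recip_dist :: "real \<Rightarrow> real" where
  "recip_dist x = 1 / (2 * x) + 1 / (2 * (1 - x))"

lemma inverse_sin_le_recip_dist:
  assumes "0 < x" "x < 1"
  shows "1 / sin (pi * x) \<le> recip_dist x"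
proof -
  have main: "1 / sin (pi * y) \<le> 1 / (2 * y)" if "0 < y" "y \<le> 1 / 2" for y
  proof -
    have "2 / pi * (pi * y) \<le> sin (pi * y)"
      using that by (intro sin_ge_two_over_pi) (auto simp: field_simps)
    then show ?thesis
      using that by (intro divide_left_mono mult_pos_pos) auto
  qed
  show ?thesis
  proof (cases "x \<le> 1 / 2")
    case True
    then show ?thesis using main[of x] assms by (auto simp: recip_dist_def add_increasing2)
  next
    case False
    have "sin (pi * (1 - x)) = sin (pi * x)"
      by (simp add: right_diff_distrib sin_diff)
    then show ?thesis
      using main[of "1 - x"] False assms by (simp add: recip_dist_def add_increasing)
  qed
qed

lemma norm_one_minus_e2pi: "norm (1 - e2pi x) = 2 * \<bar>sin (pi * x)\<bar>"
proof -
  have "(norm (1 - e2pi x))\<^sup>2 = (1 - cos (2 * (pi * x)))\<^sup>2 + (sin (2 * (pi * x)))\<^sup>2"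
    by (simp add: e2pi_def cmod_power2 mult.assoc)
  also have "\<dots> = 2 - 2 * cos (2 * (pi * x))"
    using sin_cos_squared_add[of "2 * (pi * x)"] by (simp add: power2_eq_square algebra_simps)
  also have "\<dots> = (2 * \<bar>sin (pi * x)\<bar>)\<^sup>2"
    by (simp add: cos_double_sin power2_eq_square)
  finally show ?thesis
    by (rule power2_eq_imp_eq) auto
qed

lemma norm_sum_e2pi_le:
  assumes "0 < x" "x < 1"
  shows "norm (\<Sum>j<n. e2pi (real j * x)) \<le> recip_dist x"
proof -
  have sin: "0 < sin (pi * x)"
    using assms by (intro sin_gt_zero) auto
  then have ne: "e2pi x \<noteq> 1"
    using norm_one_minus_e2pi[of x] by auto
  have "(\<Sum>j<n. e2pi (real j * x)) = (1 - e2pi x ^ n) / (1 - e2pi x)"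
    using ne by (simp add: e2pi_of_nat_mult sum_gp_strict)
  also have "norm \<dots> \<le> 2 / norm (1 - e2pi x)"
    unfolding norm_divide
  proof (rule divide_right_mono)
    show "norm (1 - e2pi x ^ n) \<le> 2"
      using norm_triangle_ineq4[of 1 "e2pi x ^ n"] by (simp add: norm_power)
  qed simp
  also have "\<dots> = 1 / sin (pi * x)"
    using sin by (simp add: norm_one_minus_e2pi)
  also have "\<dots> \<le> recip_dist x"
    using assms by (rule inverse_sin_le_recip_dist)
  finally show ?thesis .
qed

lemma norm_sum_e2pi_symmetric_le:
  assumes "frac x \<noteq> 0"
  shows "norm (\<Sum>h\<in>{- int N..int N}. e2pi (of_int h * x)) \<le> recip_dist (frac x)"
proof -
  have frac: "e2pi (of_int h * x) = e2pi (of_int h * frac x)" for h :: int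
    by (rule e2pi_cong) (simp add: frac_def algebra_simps flip: of_int_mult)
  have "(\<Sum>h\<in>{- int N..int N}. e2pi (of_int h * x)) =
        (\<Sum>j<2 * N + 1. e2pi (of_int (int j - int N) * x))"
    by (rule sum.reindex_bij_witness[of _ "\<lambda>j. int j - int N" "\<lambda>h. nat (h + int N)"]) auto
  also have "\<dots> = e2pi (- real N * frac x) * (\<Sum>j<2 * N + 1. e2pi (real j * frac x))"
    unfolding frac sum_distrib_left e2pi_add[symmetric] by (simp add: algebra_simps)
  also have "norm \<dots> = norm (\<Sum>j<2 * N + 1. e2pi (real j * frac x))"
    by (simp add: norm_mult)
  also have "\<dots> \<le> recip_dist (frac x)"
    using assms frac_ge_0[of x] frac_lt_1[of x] by (intro norm_sum_e2pi_le) auto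
  finally show ?thesis .
qed

lemma frac_uminus_nonint: "frac x \<noteq> 0 \<Longrightarrow> frac (- x) = 1 - frac (x :: real)"
  by (auto simp: frac_neg frac_eq_0_iff)

text \<open>Both orders of \<open>i\<close> and \<open>j\<close> are covered, and
  \<open>frac (- x) = 1 - frac x\<close> off the integers; so for \<open>K > 0\<close> the one-sided
  condition bounds the distance on the circle.\<close>

definition spaced :: "'i set \<Rightarrow> ('i \<Rightarrow> real) \<Rightarrow> nat \<Rightarrow> bool" where
  "spaced I \<theta> K \<longleftrightarrow> (\<forall>i\<in>I. \<forall>j\<in>I. i \<noteq> j \<longrightarrow> 1 / real K \<le> frac (\<theta> i - \<theta> j))"

text \<open>The circle is cut into arcs of length \<open>1 / K\<close> starting at
  \<open>\<theta> i\<close>, and \<open>g\<close> numbers them. By the spacing, each arc holds at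
  most one other point and arc \<open>0\<close> holds none, so the sum is at most that of
  \<open>K / n\<close> for \<open>n\<close> from \<open>1\<close> to \<open>K\<close>.\<close>

lemma sum_inverse_frac_spaced_le:
  assumes "finite I" "spaced I \<theta> K" "K > 0" "i \<in> I"
  shows "(\<Sum>j\<in>I - {i}. 1 / frac (\<theta> j - \<theta> i)) \<le> real K * harm K"
proof -
  define g where "g j = nat \<lfloor>real K * frac (\<theta> j - \<theta> i)\<rfloor>" for j
  have sp: "1 / real K \<le> frac (\<theta> j - \<theta> j')" if "j \<in> I" "j' \<in> I" "j \<noteq> j'" for j j'
    using assms that by (auto simp: spaced_def)
  have g1: "real (g j) \<le> real K * frac (\<theta> j - \<theta> i)" for j
    using frac_ge_0[of "\<theta> j - \<theta> i"] by (simp add: g_def)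
  have g2: "real K * frac (\<theta> j - \<theta> i) < real (g j) + 1" for j
    unfolding g_def by linarith
  have range: "g j \<in> {1..K}" if "j \<in> I - {i}" for j
  proof -
    have "1 \<le> real K * frac (\<theta> j - \<theta> i)"
      using sp[of j i] that assms by (simp add: field_simps)
    then have "1 \<le> g j" unfolding g_def by linarith
    moreover have "real K * frac (\<theta> j - \<theta> i) \<le> real K"
      using frac_lt_1[of "\<theta> j - \<theta> i"] by (simp add: mult_left_le)
    ultimately show ?thesis using g1[of j] by auto
  qed
  have inj: "inj_on g (I - {i})"
  proof (rule inj_onI)
    have less: False if jj: "j \<in> I" "j' \<in> I" "j \<noteq> j'" "g j = g j'"
      and le: "frac (\<theta> j' - \<theta> i) \<le> frac (\<theta> j - \<theta> i)" for j j'
    proof -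
      have "real K * (frac (\<theta> j - \<theta> i) - frac (\<theta> j' - \<theta> i)) < 1"
        using g1[of j'] g2[of j] jj by (simp add: algebra_simps)
      then have small: "frac (\<theta> j - \<theta> i) - frac (\<theta> j' - \<theta> i) < 1 / real K"
        using assms by (simp add: field_simps)
      have "frac (\<theta> j - \<theta> j') = frac (\<theta> j - \<theta> i) - frac (\<theta> j' - \<theta> i)"
      proof (subst frac_unique_iff, intro conjI)
        show "\<theta> j - \<theta> j' - (frac (\<theta> j - \<theta> i) - frac (\<theta> j' - \<theta> i)) \<in> \<int>"
          by (simp add: frac_def flip: of_int_diff)
        show "frac (\<theta> j - \<theta> i) - frac (\<theta> j' - \<theta> i) < 1"
          using frac_lt_1[of "\<theta> j - \<theta> i"] frac_ge_0[of "\<theta> j' - \<theta> i"] by linarith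
      qed (use le in auto)
      then show False using sp[OF jj(1-3)] small by simp
    qed
    fix j j' assume "j \<in> I - {i}" "j' \<in> I - {i}" "g j = g j'"
    then show "j = j'"
      using less[of j j'] less[of j' j] by (metis DiffD1 linear)
  qed
  have "(\<Sum>j\<in>I - {i}. 1 / frac (\<theta> j - \<theta> i)) \<le> (\<Sum>j\<in>I - {i}. real K / real (g j))"
  proof (rule sum_mono)
    fix j assume j: "j \<in> I - {i}"
    have "0 < 1 / real K" using assms by simp
    also have "\<dots> \<le> frac (\<theta> j - \<theta> i)" using sp[of j i] j assms by blast
    finally have "frac (\<theta> j - \<theta> i) > 0" .
    moreover have "real (g j) > 0" using range[OF j] by simp
    ultimately show "1 / frac (\<theta> j - \<theta> i) \<le> real K / real (g j)"
      using g1[of j] by (simp add: field_simps)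
  qed
  also have "\<dots> = (\<Sum>n\<in>g ` (I - {i}). real K / real n)"
    by (simp add: sum.reindex[OF inj])
  also have "\<dots> \<le> (\<Sum>n\<in>{1..K}. real K / real n)"
    using range by (intro sum_mono2) (auto simp del: atLeastAtMost_iff)
  also have "\<dots> = real K * harm K"
    by (simp add: harm_def sum_distrib_left divide_inverse)
  finally show ?thesis .
qed

text \<open>The diagonal term is \<open>2 * N + 1\<close>. Off the diagonal, the two halves of
  \<open>recip_dist\<close> give the previous sum for the points \<open>\<theta> j\<close> and for
  their negatives, each with weight \<open>1 / 2\<close>.\<close>

lemma sum_norm_kernel_le:
  assumes "finite I" "spaced I \<theta> K" "K > 0" "i \<in> I"
  shows "(\<Sum>j\<in>I. norm (\<Sum>h\<in>{- int N..int N}. e2pi (of_int h * (\<theta> j - \<theta> i)))) \<le>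
    2 * real N + 1 + real K * harm K"
proof -
  have nz: "frac (\<theta> j - \<theta> k) \<noteq> 0" if "j \<in> I" "k \<in> I" "j \<noteq> k" for j k
  proof -
    have "0 < 1 / real K" using assms by simp
    also have "\<dots> \<le> frac (\<theta> j - \<theta> k)" using assms that by (auto simp: spaced_def)
    finally show ?thesis by simp
  qed
  have spaced': "spaced I (\<lambda>j. - \<theta> j) K"
    using assms(2) by (auto simp: spaced_def)
  have "(\<Sum>j\<in>I - {i}. norm (\<Sum>h\<in>{- int N..int N}. e2pi (of_int h * (\<theta> j - \<theta> i)))) \<le>
      (\<Sum>j\<in>I - {i}. recip_dist (frac (\<theta> j - \<theta> i)))"
    using nz assms by (intro sum_mono norm_sum_e2pi_symmetric_le) auto
  also have "\<dots> = (\<Sum>j\<in>I - {i}. (1 / frac (\<theta> j - \<theta> i) + 1 / frac (- \<theta> j - - \<theta> i)) / 2)"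
  proof (rule sum.cong)
    fix j assume "j \<in> I - {i}"
    then have "frac (- (\<theta> j - \<theta> i)) = 1 - frac (\<theta> j - \<theta> i)"
      using nz assms by (intro frac_uminus_nonint) auto
    then have "frac (\<theta> i - \<theta> j) = 1 - frac (\<theta> j - \<theta> i)" by simp
    then show "recip_dist (frac (\<theta> j - \<theta> i)) =
        (1 / frac (\<theta> j - \<theta> i) + 1 / frac (- \<theta> j - - \<theta> i)) / 2"
      by (simp add: recip_dist_def add_divide_distrib mult.commute)
  qed simp
  also have "\<dots> \<le> (real K * harm K + real K * harm K) / 2"
    unfolding sum_divide_distrib[symmetric] sum.distrib
    by (intro divide_right_mono add_mono sum_inverse_frac_spaced_le
        sum_inverse_frac_spaced_le[of I "\<lambda>j. - \<theta> j"] assms spaced') simp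
  finally have "(\<Sum>j\<in>I - {i}. norm (\<Sum>h\<in>{- int N..int N}. e2pi (of_int h * (\<theta> j - \<theta> i)))) \<le> real K * harm K"
    by (simp add: mult.commute)
  moreover have "norm (\<Sum>h\<in>{- int N..int N}. e2pi (of_int h * (\<theta> i - \<theta> i))) = 2 * real N + 1"
    using norm_of_nat[of "2 * N + 1", where ?'a = complex] by (simp add: add.commute)
  ultimately show ?thesis
    using assms by (subst sum.remove[of I i]) auto
qed

text \<open>Expanding the square gives a quadratic form in \<open>w\<close> with kernel
  \<open>D\<close>. Schur's test applies: \<open>w i * w j\<close> is bounded by the mean of the two
  squares, and the symmetry of \<open>norm (D i j)\<close> leaves only the row sums.\<close>

lemma large_sieve_dual:
  fixes w :: "'i \<Rightarrow> real"
  assumes "finite I" "spaced I \<theta> K" "K > 0"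
  shows "(\<Sum>h\<in>{- int N..int N}. (norm (\<Sum>i\<in>I. of_real (w i) * e2pi (of_int h * \<theta> i)))\<^sup>2) \<le>
    (2 * real N + 1 + real K * harm K) * (\<Sum>i\<in>I. (w i)\<^sup>2)"
proof -
  define D where "D i j = (\<Sum>h\<in>{- int N..int N}. e2pi (of_int h * (\<theta> j - \<theta> i)))" for i j
  let ?S = "\<Sum>h\<in>{- int N..int N}. (norm (\<Sum>i\<in>I. of_real (w i) * e2pi (of_int h * \<theta> i)))\<^sup>2"
  have sym: "norm (D i j) = norm (D j i)" for i j
  proof -
    have "D i j = cnj (D j i)"
      by (simp add: D_def e2pi_uminus[symmetric] algebra_simps)
    then show ?thesis by simp
  qed
  have "of_real ?S = (\<Sum>h\<in>{- int N..int N}. \<Sum>i\<in>I. \<Sum>j\<in>I.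
      of_real (w i * w j) * e2pi (of_int h * (\<theta> j - \<theta> i)))"
  proof (simp only: of_real_sum, rule sum.cong)
    fix h :: int
    have "of_real ((norm (\<Sum>i\<in>I. of_real (w i) * e2pi (of_int h * \<theta> i)))\<^sup>2) =
      cnj (\<Sum>i\<in>I. of_real (w i) * e2pi (of_int h * \<theta> i)) * (\<Sum>i\<in>I. of_real (w i) * e2pi (of_int h * \<theta> i))"
      by (subst complex_norm_square) (rule mult.commute)
    also have "\<dots> = (\<Sum>i\<in>I. of_real (w i) * e2pi (- (of_int h * \<theta> i))) * (\<Sum>i\<in>I. of_real (w i) * e2pi (of_int h * \<theta> i))"
      by (simp add: e2pi_uminus)
    also have "\<dots> = (\<Sum>i\<in>I. \<Sum>j\<in>I. of_real (w i * w j) * e2pi (of_int h * (\<theta> j - \<theta> i)))"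
    proof -
      have "e2pi (of_int h * (\<theta> j - \<theta> i)) = e2pi (- (of_int h * \<theta> i)) * e2pi (of_int h * \<theta> j)" for i j
        by (simp add: algebra_simps flip: e2pi_add)
      then show ?thesis
        unfolding sum_product by (intro sum.cong) simp_all
    qed
    finally show "of_real ((norm (\<Sum>i\<in>I. of_real (w i) * e2pi (of_int h * \<theta> i)))\<^sup>2) =
      (\<Sum>i\<in>I. \<Sum>j\<in>I. of_real (w i * w j) * e2pi (of_int h * (\<theta> j - \<theta> i)))" .
  qed simp
  also have "\<dots> = (\<Sum>i\<in>I. \<Sum>j\<in>I. of_real (w i * w j) * D i j)"
    unfolding D_def sum_distrib_left
    by (subst sum.swap, rule sum.cong [OF refl], subst sum.swap, rule refl)
  finally have "?S = norm (\<Sum>i\<in>I. \<Sum>j\<in>I. of_real (w i * w j) * D i j)"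
    by (metis (no_types, lifting) abs_of_nonneg norm_of_real sum_nonneg zero_le_power2)
  also have "\<dots> \<le> (\<Sum>i\<in>I. \<Sum>j\<in>I. norm (of_real (w i * w j) * D i j))"
    by (intro order.trans[OF norm_sum] sum_mono norm_sum)
  also have "\<dots> \<le> (\<Sum>i\<in>I. \<Sum>j\<in>I. ((w i)\<^sup>2 + (w j)\<^sup>2) / 2 * norm (D i j))"
  proof (intro sum_mono)
    fix i j
    have "\<bar>w i * w j\<bar> \<le> ((w i)\<^sup>2 + (w j)\<^sup>2) / 2"
      using sum_squares_bound[of "\<bar>w i\<bar>" "\<bar>w j\<bar>"] by (simp add: abs_mult)
    then show "norm (of_real (w i * w j) * D i j) \<le> ((w i)\<^sup>2 + (w j)\<^sup>2) / 2 * norm (D i j)"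
      unfolding norm_mult norm_of_real by (intro mult_right_mono) auto
  qed
  also have "\<dots> = ((\<Sum>i\<in>I. \<Sum>j\<in>I. (w i)\<^sup>2 * norm (D i j)) + (\<Sum>i\<in>I. \<Sum>j\<in>I. (w j)\<^sup>2 * norm (D i j))) / 2"
    by (simp add: sum.distrib sum_divide_distrib add_divide_distrib distrib_right)
  also have "(\<Sum>i\<in>I. \<Sum>j\<in>I. (w j)\<^sup>2 * norm (D i j)) = (\<Sum>i\<in>I. \<Sum>j\<in>I. (w i)\<^sup>2 * norm (D i j))"
    by (subst sum.swap) (simp add: sym)
  also have "((\<Sum>i\<in>I. \<Sum>j\<in>I. (w i)\<^sup>2 * norm (D i j)) + (\<Sum>i\<in>I. \<Sum>j\<in>I. (w i)\<^sup>2 * norm (D i j))) / 2 =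
      (\<Sum>i\<in>I. (w i)\<^sup>2 * (\<Sum>j\<in>I. norm (D i j)))"
    unfolding sum_distrib_left by simp
  also have "\<dots> \<le> (\<Sum>i\<in>I. (w i)\<^sup>2 * (2 * real N + 1 + real K * harm K))"
    unfolding D_def by (intro sum_mono mult_left_mono sum_norm_kernel_le assms) auto
  finally show ?thesis
    by (simp add: sum_distrib_left sum_distrib_right mult.commute)
qed

text \<open>Two distinct fractions of this kind differ modulo 1 by a nonzero multiple of
  \<open>1 / (p * p')\<close>, and \<open>p * p'\<close> is at most the square of
  \<open>Q\<close>.\<close>

lemma spaced_fractions:
  assumes "\<And>p. p \<in> P \<Longrightarrow> prime p \<and> p \<le> Q"
  shows "spaced (SIGMA p:P. {1..<p}) (\<lambda>(p, b). real b / real p) (Q\<^sup>2)"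
proof -
  have "1 / real (Q\<^sup>2) \<le> frac (real b / real p - real b' / real p')"
    if *: "p \<in> P" "b \<in> {1..<p}" "p' \<in> P" "b' \<in> {1..<p'}" "\<not> (p = p' \<and> b = b')" for p b p' b'
  proof -
    have pr: "prime p" "prime p'" "p \<le> Q" "p' \<le> Q" using * assms by auto
    have pos: "p > 0" "p' > 0" using pr by (auto intro: prime_gt_0_nat)
    define k where "k = \<lfloor>real b / real p - real b' / real p'\<rfloor>"
    define m where "m = int b * int p' - int b' * int p - k * (int p * int p')"
    have frac: "frac (real b / real p - real b' / real p') = of_int m / real (p * p')"
      using pos unfolding frac_def k_def[symmetric] m_def by (simp add: field_simps)
    \<comment> \<open>A vanishing numerator makes \<open>p\<close> divide \<open>b * p'\<close>;
      since \<open>0 < b < p\<close>, this forces \<open>p = p'\<close> and then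
      \<open>b = b'\<close>.\<close>
    have "m \<noteq> 0"
    proof
      assume m: "m = 0"
      then have "int b * int p' = int p * (int b' + k * int p')"
        by (simp add: m_def algebra_simps)
      then have "int p dvd int (b * p')" by simp
      then have "p dvd b * p'" by (simp only: int_dvd_int_iff)
      moreover have "\<not> p dvd b" using * by (auto dest: dvd_imp_le)
      ultimately have "p = p'" using pr by (auto simp: prime_dvd_mult_iff primes_dvd_imp_eq)
      have "int p * (int b - int b' - int p * k) = 0"
        using m \<open>p = p'\<close> by (simp add: m_def algebra_simps)
      then have "int b - int b' = int p * k" using pos by simp
      then have "int p dvd int b - int b'" by simp
      then have "[int b = int b'] (mod int p)" by (simp add: cong_iff_dvd_diff)
      then have "b = b'" using * \<open>p = p'\<close> by (auto simp: cong_int_iff cong_less_modulus_unique_nat)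
      then show False using * \<open>p = p'\<close> by simp
    qed
    moreover have "of_int m / real (p * p') \<ge> 0"
      using frac_ge_0[of "real b / real p - real b' / real p'"] unfolding frac .
    moreover have "of_int m / real (p * p') < 0" if "m < 0"
      using that pos by (intro divide_neg_pos) auto
    ultimately have "m \<ge> 1" by linarith
    moreover have "p * p' \<le> Q\<^sup>2" using pr by (simp add: power2_eq_square mult_mono)
    then have "real (p * p') \<le> real (Q\<^sup>2)" by (rule of_nat_mono)
    ultimately show ?thesis
      unfolding frac using pos by (intro frac_le) auto
  qed
  then show ?thesis unfolding spaced_def by auto
qed

section \<open>Differences, additive energy and Fourier coefficients\<close>

definition diff_count :: "int set \<Rightarrow> int \<Rightarrow> nat" where
  "diff_count B h = card {n\<in>B. n - h \<in> B}"

text \<open>When \<open>B\<close> lies in \<open>{1..N}\<close>, every difference is in the range of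
  summation, so this is the number of quadruples from \<open>B\<close> with two equal
  differences.\<close>

definition energy :: "int set \<Rightarrow> nat \<Rightarrow> nat" where
  "energy B N = (\<Sum>h\<in>{- int N..int N}. (diff_count B h)\<^sup>2)"

lemma sum_diff_count:
  fixes f :: "int \<Rightarrow> 'a :: comm_ring_1"
  assumes "B \<subseteq> {1..int N}"
  shows "(\<Sum>m\<in>B. \<Sum>n\<in>B. f (n - m)) = (\<Sum>h\<in>{- int N..int N}. of_nat (diff_count B h) * f h)"
proof -
  have fin: "finite B" using assms finite_subset by blast
  have "(\<Sum>m\<in>B. \<Sum>n\<in>B. f (n - m)) = (\<Sum>n\<in>B. \<Sum>m\<in>B. f (n - m))"
    by (rule sum.swap)
  also have "\<dots> = (\<Sum>n\<in>B. \<Sum>h | h \<in> {- int N..int N} \<and> n - h \<in> B. f h)"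
  proof (rule sum.cong [OF refl])
    fix n assume "n \<in> B"
    have m: "1 \<le> m \<and> m \<le> int N" if "m \<in> B" for m
      using assms that by auto
    from \<open>n \<in> B\<close>
    show "(\<Sum>m\<in>B. f (n - m)) = (\<Sum>h | h \<in> {- int N..int N} \<and> n - h \<in> B. f h)"
      by (intro sum.reindex_bij_witness[of _ "\<lambda>h. n - h" "\<lambda>m. n - m"]) (auto, (smt (verit) m)+)
  qed
  also have "\<dots> = (\<Sum>h\<in>{- int N..int N}. \<Sum>n | n \<in> B \<and> n - h \<in> B. f h)"
    using fin by (intro sum.swap_restrict) auto
  finally show ?thesis by (simp add: diff_count_def)
qed

text \<open>The squared Fourier coefficients of \<open>B\<close> are the Fourier transform of
  \<open>diff_count B\<close>. Cauchy-Schwarz over \<open>h\<close> then separates the energy from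
  the exponential sum with coefficients \<open>w\<close>, which the dual large sieve bounds.\<close>

lemma fourier_energy_bound:
  fixes w :: "'i \<Rightarrow> real"
  assumes B: "B \<subseteq> {1..int N}" and I: "finite I" "spaced I \<theta> K" "K > 0"
  shows "(\<Sum>i\<in>I. w i * (norm (\<Sum>n\<in>B. e2pi (of_int n * \<theta> i)))\<^sup>2)\<^sup>2 \<le>
    real (energy B N) * ((2 * real N + 1 + real K * harm K) * (\<Sum>i\<in>I. (w i)\<^sup>2))"
proof -
  define \<Psi> where "\<Psi> h = (\<Sum>i\<in>I. of_real (w i) * e2pi (of_int h * \<theta> i))" for h
  let ?S = "\<Sum>i\<in>I. w i * (norm (\<Sum>n\<in>B. e2pi (of_int n * \<theta> i)))\<^sup>2"
  have sq: "of_real ((norm (\<Sum>n\<in>B. e2pi (of_int n * \<theta> i)))\<^sup>2) =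
      (\<Sum>h\<in>{- int N..int N}. of_nat (diff_count B h) * e2pi (of_int h * \<theta> i))" for i
  proof -
    have "of_real ((norm (\<Sum>n\<in>B. e2pi (of_int n * \<theta> i)))\<^sup>2) =
        (\<Sum>n\<in>B. e2pi (- (of_int n * \<theta> i))) * (\<Sum>n\<in>B. e2pi (of_int n * \<theta> i))"
      by (subst complex_norm_square) (simp add: e2pi_uminus mult.commute)
    also have "\<dots> = (\<Sum>m\<in>B. \<Sum>n\<in>B. e2pi (of_int (n - m) * \<theta> i))"
      unfolding sum_product e2pi_add[symmetric] by (simp add: algebra_simps)
    also have "\<dots> = (\<Sum>h\<in>{- int N..int N}. of_nat (diff_count B h) * e2pi (of_int h * \<theta> i))"
      by (rule sum_diff_count [OF B])
    finally show ?thesis .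
  qed
  have "complex_of_real ?S = (\<Sum>i\<in>I. \<Sum>h\<in>{- int N..int N}. of_nat (diff_count B h) * (of_real (w i) * e2pi (of_int h * \<theta> i)))"
    by (simp only: of_real_sum of_real_mult sq sum_distrib_left mult.left_commute)
  also have "\<dots> = (\<Sum>h\<in>{- int N..int N}. of_nat (diff_count B h) * \<Psi> h)"
    unfolding \<Psi>_def sum_distrib_left by (rule sum.swap)
  finally have eq: "complex_of_real ?S = (\<Sum>h\<in>{- int N..int N}. of_nat (diff_count B h) * \<Psi> h)" .
  have "\<bar>?S\<bar> = norm (complex_of_real ?S)"
    by (simp only: norm_of_real)
  also have "\<dots> = norm (\<Sum>h\<in>{- int N..int N}. of_nat (diff_count B h) * \<Psi> h)"
    by (simp only: eq)
  also have "\<dots> \<le> (\<Sum>h\<in>{- int N..int N}. real (diff_count B h) * norm (\<Psi> h))"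
    by (intro order.trans [OF norm_sum]) (simp add: norm_mult)
  finally have "\<bar>?S\<bar>\<^sup>2 \<le> (\<Sum>h\<in>{- int N..int N}. real (diff_count B h) * norm (\<Psi> h))\<^sup>2"
    by (intro power_mono) auto
  also have "\<dots> \<le> (\<Sum>h\<in>{- int N..int N}. (real (diff_count B h))\<^sup>2) * (\<Sum>h\<in>{- int N..int N}. (norm (\<Psi> h))\<^sup>2)"
    by (rule Cauchy_Schwarz_ineq_sum)
  also have "\<dots> \<le> real (energy B N) * ((2 * real N + 1 + real K * harm K) * (\<Sum>i\<in>I. (w i)\<^sup>2))"
    unfolding energy_def \<Psi>_def of_nat_sum of_nat_power
    by (intro mult_left_mono large_sieve_dual I sum_nonneg) auto
  finally show ?thesis by simp
qed

section \<open>From confinement modulo many primes to large energy\<close>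

section \<open>Additive energy of a set lying in progressions\<close>

lemma sum_e2pi_complete:
  assumes "p > 0"
  shows "(\<Sum>c<p. e2pi (real c * (of_int k / real p))) = (if int p dvd k then of_nat p else 0)"
proof (cases "int p dvd k")
  case True
  then obtain m where "k = int p * m" by blast
  then have "real c * (of_int k / real p) = of_int (int c * m)" for c
    using assms by simp
  then have "e2pi (real c * (of_int k / real p)) = 1" for c
    by (simp only: e2pi_of_int)
  with True show ?thesis by simp
next
  case False
  let ?z = "e2pi (of_int k / real p)"
  have "?z \<noteq> 1"
  proof
    assume "?z = 1"
    then have "sin (pi * (of_int k / real p)) = 0"
      using norm_one_minus_e2pi[of "of_int k / real p"] by simp
    then obtain i where "pi * (of_int k / real p) = of_int i * pi"
      by (auto simp: sin_zero_iff_int2)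
    then have "real_of_int k = of_int (i * int p)"
      using assms by (simp add: field_simps)
    then have "k = i * int p" by linarith
    with False show False by simp
  qed
  moreover have "?z ^ p = 1"
    using assms by (simp flip: e2pi_of_nat_mult)
  ultimately show ?thesis
    using False by (simp add: e2pi_of_nat_mult sum_gp_strict del: times_divide_eq_right)
qed

text \<open>This dilation permutes the nonzero frequencies, so that a progression with difference
  \<open>d\<close> can be treated as an interval.\<close>

lemma bij_betw_mult_mod_prime:
  assumes "prime p" "\<not> [d = 0] (mod int p)"
  shows "bij_betw (\<lambda>b. nat (int b * d mod int p)) {1..<p} {1..<p}"
proof -
  have pd: "\<not> int p dvd d" using assms by (simp add: cong_0_iff)
  have p0: "int p > 0" using prime_gt_0_nat[OF assms(1)] by simp
  have pp: "prime (int p)" using assms by simp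
  have inj: "inj_on (\<lambda>b. nat (int b * d mod int p)) {1..<p}"
  proof (rule inj_onI)
    fix b c assume bc: "b \<in> {1..<p}" "c \<in> {1..<p}"
      and "nat (int b * d mod int p) = nat (int c * d mod int p)"
    then have "[int b * d = int c * d] (mod int p)"
      using p0 by (simp add: nat_eq_iff Cong.cong_def)
    then have "[int b = int c] (mod int p)"
      using prime_imp_coprime[OF pp pd] by (subst (asm) cong_mult_rcancel) (auto simp: coprime_commute)
    then show "b = c"
      using bc by (auto simp: cong_int_iff cong_less_modulus_unique_nat)
  qed
  moreover have "(\<lambda>b. nat (int b * d mod int p)) ` {1..<p} \<subseteq> {1..<p}"
  proof (intro image_subsetI)
    fix b assume b: "b \<in> {1..<p}"
    have "\<not> int p dvd int b * d"
      using b pd pp by (auto simp: prime_dvd_mult_iff dest: nat_dvd_not_less)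
    then have "int b * d mod int p \<noteq> 0" by (simp add: dvd_eq_mod_eq_0)
    moreover have "0 \<le> int b * d mod int p" "int b * d mod int p < int p"
      using p0 by (simp_all del: of_nat_0_less_iff)
    ultimately show "nat (int b * d mod int p) \<in> {1..<p}" by auto
  qed
  ultimately show ?thesis
    by (intro bij_betw_imageI endo_inj_surj) auto
qed

lemma sum_fourier_weight:
  assumes "p > 0"
  shows "(\<Sum>c\<in>{1..<p}. 1 / (2 * real c) + 1 / (2 * (real p - real c))) = harm (p - 1)"
proof -
  have "(\<Sum>c\<in>{1..<p}. 1 / (2 * (real p - real c))) = (\<Sum>c\<in>{1..<p}. 1 / (2 * real c))"
    by (rule sum.reindex_bij_witness[of _ "\<lambda>c. p - c" "\<lambda>c. p - c"]) (auto simp: of_nat_diff)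
  then have "(\<Sum>c\<in>{1..<p}. 1 / (2 * real c) + 1 / (2 * (real p - real c))) = (\<Sum>c\<in>{1..<p}. 1 / (2 * real c) + 1 / (2 * real c))"
    by (simp only: sum.distrib)
  also have "\<dots> = (\<Sum>c\<in>{1..<p}. inverse (real c))"
    by (rule sum.cong) (auto simp: field_simps)
  also have "\<dots> = harm (p - 1)"
    unfolding harm_def using assms by (intro sum.cong) auto
  finally show ?thesis .
qed

text \<open>The geometric sums over a progression decay so fast that their \<open>\<ell>\<^sup>1\<close> norm is only
  logarithmic in \<open>p\<close>. This is what produces large Fourier coefficients at denominator \<open>p\<close>, and it
  fails for general sets of residues.\<close>

lemma fourier_of_progression:
  fixes B :: "int set" and \<epsilon> :: real
  assumes p: "prime p" and d: "\<not> [d = 0] (mod int p)" and "finite B" and "0 < \<epsilon>"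
    and L: "real L \<le> (1 - \<epsilon>) * real p"
    and x: "\<And>n. n \<in> B \<Longrightarrow> x n < L \<and> [n = a + int (x n) * d] (mod int p)"
  obtains w :: "nat \<Rightarrow> real" where
    "\<And>b. b \<in> {1..<p} \<Longrightarrow> 0 \<le> w b \<and> w b \<le> 1" "sum w {1..<p} = harm (p - 1)"
    "(\<epsilon> * card B)\<^sup>2 \<le>
       harm (p - 1) * (\<Sum>b\<in>{1..<p}. w b * (norm (\<Sum>n\<in>B. e2pi (of_int n * (real b / real p))))\<^sup>2)"
proof -
  \<comment> \<open>This is \<open>recip_dist (c / p) / p\<close>: the geometric sum bound, rescaled
    so as not to exceed 1.\<close>
  define \<omega> where "\<omega> c = 1 / (2 * real c) + 1 / (2 * (real p - real c))" for c
  define \<phi> where "\<phi> b = nat (int b * d mod int p)" for b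
  define F where "F c = norm (\<Sum>n\<in>B. e2pi (real c * (real (x n) / real p)))" for c
  define g where "g c = (\<Sum>j<L. e2pi (real c * (real j / real p)))" for c
  have p0: "p > 0" using p by (rule prime_gt_0_nat)
  have \<omega>: "0 \<le> \<omega> c \<and> \<omega> c \<le> 1" if "c \<in> {1..<p}" for c
  proof -
    have c: "real p - real c \<ge> 1" "real c \<ge> 1" using that by auto
    have "1 / (2 * real c) \<le> 1 / 2" "1 / (2 * (real p - real c)) \<le> 1 / 2"
      using c divide_left_mono[of 2 "2 * real c" 1] divide_left_mono[of 2 "2 * (real p - real c)" 1] by auto
    then show ?thesis
      using c unfolding \<omega>_def by (intro conjI add_nonneg_nonneg) (linarith | simp)+
  qed
  have \<phi>: "bij_betw \<phi> {1..<p} {1..<p}"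
    unfolding \<phi>_def using p d by (rule bij_betw_mult_mod_prime)
  \<comment> \<open>As \<open>n\<close> is \<open>a + x n * d\<close> modulo \<open>p\<close>, the
    frequency \<open>b\<close> on \<open>B\<close> is the frequency \<open>b * d\<close> on the
    positions \<open>x n\<close>; the offset \<open>a\<close> only gives a factor of modulus
    1.\<close>
  have F: "norm (\<Sum>n\<in>B. e2pi (of_int n * (real b / real p))) = F (\<phi> b)" for b
  proof -
    have "e2pi (of_int n * (real b / real p)) =
        e2pi (of_int a * (real b / real p)) * e2pi (real (\<phi> b) * (real (x n) / real p))" if "n \<in> B" for n
    proof -
      have "[int (\<phi> b) * int (x n) = int b * d * int (x n)] (mod int p)"
        using p0 by (intro cong_mult) (auto simp: \<phi>_def Cong.cong_def)
      moreover have "[int b * n = int b * (a + int (x n) * d)] (mod int p)"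
        using x[OF that] by (intro cong_mult) auto
      ultimately have "[int b * n = int b * a + int (\<phi> b) * int (x n)] (mod int p)"
        by (simp add: Cong.cong_def algebra_simps) (metis mod_add_right_eq)
      then obtain m where m: "int b * n - (int b * a + int (\<phi> b) * int (x n)) = int p * m"
        by (auto simp: cong_iff_dvd_diff)
      have "of_int n * (real b / real p) -
          (of_int a * (real b / real p) + real (\<phi> b) * (real (x n) / real p)) =
          real_of_int (int b * n - (int b * a + int (\<phi> b) * int (x n))) / real p"
        by (simp add: diff_divide_distrib add_divide_distrib mult_ac)
      also have "\<dots> = of_int m"
        using p0 by (subst m) simp
      finally show ?thesis
        unfolding e2pi_add[symmetric] by (intro e2pi_cong) simp
    qed
    then have "(\<Sum>n\<in>B. e2pi (of_int n * (real b / real p))) =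
        e2pi (of_int a * (real b / real p)) * (\<Sum>n\<in>B. e2pi (real (\<phi> b) * (real (x n) / real p)))"
      unfolding sum_distrib_left by (rule sum.cong [OF refl])
    then show ?thesis by (simp add: F_def norm_mult)
  qed
  have orth: "(\<Sum>c\<in>{1..<p}. e2pi (real c * (of_int k / real p))) = (if k = 0 then of_nat p else 0) - 1"
    if "\<bar>k\<bar> < int p" for k
  proof -
    have "{..<p} = insert 0 {1..<p}" using p0 by auto
    then have "(\<Sum>c<p. e2pi (real c * (of_int k / real p))) =
        1 + (\<Sum>c\<in>{1..<p}. e2pi (real c * (of_int k / real p)))" by simp
    moreover have "int p dvd k \<longleftrightarrow> k = 0"
      using that dvd_imp_le_int[of k "int p"] by auto
    ultimately show ?thesis
      using sum_e2pi_complete[OF p0, of k] by (simp add: algebra_simps split: if_splits)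
  qed
  have Lp: "real L \<le> real p"
    using L mult_right_mono[of "1 - \<epsilon>" 1 "real p"] \<open>0 < \<epsilon>\<close> by simp
  \<comment> \<open>The positions are paired with the interval \<open>{..<L}\<close> over all
    nonzero frequencies. Each position equals one \<open>j < L\<close>, which gives
    \<open>p\<close>, and the omitted frequency \<open>0\<close> takes away \<open>L\<close>; so
    \<open>(p - L) * card B\<close> remains.\<close>
  have "(\<Sum>c\<in>{1..<p}. cnj (g c) * (\<Sum>n\<in>B. e2pi (real c * (real (x n) / real p)))) =
      (\<Sum>n\<in>B. \<Sum>j<L. \<Sum>c\<in>{1..<p}. e2pi (real c * (of_int (int (x n) - int j) / real p)))"
  proof -
    have "cnj (g c) * (\<Sum>n\<in>B. e2pi (real c * (real (x n) / real p))) =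
        (\<Sum>n\<in>B. \<Sum>j<L. e2pi (real c * (of_int (int (x n) - int j) / real p)))" for c
    proof -
      have "e2pi (real c * (of_int (int (x n) - int j) / real p)) =
          e2pi (- (real c * (real j / real p))) * e2pi (real c * (real (x n) / real p))" for n j
        unfolding e2pi_add[symmetric] by (simp add: algebra_simps diff_divide_distrib)
      then show ?thesis
        by (simp add: g_def sum_product e2pi_uminus) (rule sum.swap)
    qed
    then show ?thesis
      by (simp only:) (subst sum.swap, rule sum.cong [OF refl], rule sum.swap)
  qed
  also have "\<dots> = (\<Sum>n\<in>B. of_real (real p - real L))"
  proof (rule sum.cong [OF refl])
    fix n assume n: "n \<in> B"
    have "(\<Sum>j<L. \<Sum>c\<in>{1..<p}. e2pi (real c * (of_int (int (x n) - int j) / real p))) =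
        (\<Sum>j<L. (if x n = j then of_nat p else 0) - 1)"
      using x[OF n] Lp by (intro sum.cong [OF refl], subst orth) auto
    also have "\<dots> = of_real (real p - real L)"
      using x[OF n] by (simp add: sum_subtractf)
    finally show "(\<Sum>j<L. \<Sum>c\<in>{1..<p}. e2pi (real c * (of_int (int (x n) - int j) / real p))) =
      of_real (real p - real L)" .
  qed
  also have "\<dots> = of_real ((real p - real L) * card B)"
    by (simp add: mult.commute)
  finally have eq: "(\<Sum>c\<in>{1..<p}. cnj (g c) * (\<Sum>n\<in>B. e2pi (real c * (real (x n) / real p)))) =
      of_real ((real p - real L) * card B)" .
  have "(real p - real L) * card B = norm (\<Sum>c\<in>{1..<p}. cnj (g c) * (\<Sum>n\<in>B. e2pi (real c * (real (x n) / real p))))"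
    unfolding eq norm_of_real using Lp by simp
  also have "\<dots> \<le> (\<Sum>c\<in>{1..<p}. norm (g c) * F c)"
    by (intro order.trans [OF norm_sum]) (simp add: norm_mult F_def)
  also have "\<dots> \<le> (\<Sum>c\<in>{1..<p}. real p * \<omega> c * F c)"
  proof (intro sum_mono mult_right_mono)
    fix c assume c: "c \<in> {1..<p}"
    have "norm (g c) = norm (\<Sum>j<L. e2pi (real j * (real c / real p)))"
      by (simp add: g_def mult.commute)
    also have "\<dots> \<le> recip_dist (real c / real p)"
      using c p0 by (intro norm_sum_e2pi_le) auto
    also have "\<dots> = real p * \<omega> c"
      using c p0 by (simp add: recip_dist_def \<omega>_def field_simps)
    finally show "norm (g c) \<le> real p * \<omega> c" .
  qed (simp add: F_def)
  finally have "real p * (\<epsilon> * card B) \<le> real p * (\<Sum>c\<in>{1..<p}. \<omega> c * F c)"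
    using mult_right_mono[OF L, of "real (card B)"] by (simp add: algebra_simps sum_distrib_left)
  then have main: "\<epsilon> * card B \<le> (\<Sum>c\<in>{1..<p}. \<omega> c * F c)"
    using p0 by simp
  \<comment> \<open>Cauchy-Schwarz with weight \<open>\<omega>\<close> replaces the first moment of
    \<open>F\<close> by the second, at the price of the total weight
    \<open>harm (p - 1)\<close>.\<close>
  have "(\<epsilon> * card B)\<^sup>2 \<le> (\<Sum>c\<in>{1..<p}. \<omega> c * F c)\<^sup>2"
    using main \<open>0 < \<epsilon>\<close> by (intro power_mono) auto
  also have "\<dots> = (\<Sum>c\<in>{1..<p}. sqrt (\<omega> c) * (sqrt (\<omega> c) * F c))\<^sup>2"
    using \<omega> by (intro arg_cong[of _ _ "\<lambda>t. t\<^sup>2"] sum.cong) auto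
  also have "\<dots> \<le> (\<Sum>c\<in>{1..<p}. (sqrt (\<omega> c))\<^sup>2) * (\<Sum>c\<in>{1..<p}. (sqrt (\<omega> c) * F c)\<^sup>2)"
    by (rule Cauchy_Schwarz_ineq_sum)
  also have "\<dots> = (\<Sum>c\<in>{1..<p}. \<omega> c) * (\<Sum>c\<in>{1..<p}. \<omega> c * (F c)\<^sup>2)"
    using \<omega> by (intro arg_cong2[of _ _ _ _ "(*)"] sum.cong) (auto simp: power_mult_distrib)
  also have "(\<Sum>c\<in>{1..<p}. \<omega> c) = harm (p - 1)"
    unfolding \<omega>_def using p0 by (rule sum_fourier_weight)
  also have "(\<Sum>c\<in>{1..<p}. \<omega> c * (F c)\<^sup>2) = (\<Sum>b\<in>{1..<p}. \<omega> (\<phi> b) * (F (\<phi> b))\<^sup>2)"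
    by (rule sum.reindex_bij_betw [OF \<phi>, symmetric])
  finally have "(\<epsilon> * card B)\<^sup>2 \<le> harm (p - 1) * (\<Sum>b\<in>{1..<p}. \<omega> (\<phi> b) * (norm (\<Sum>n\<in>B. e2pi (of_int n * (real b / real p))))\<^sup>2)"
    by (simp only: F)
  moreover have "(\<Sum>b\<in>{1..<p}. \<omega> (\<phi> b)) = harm (p - 1)"
    using sum.reindex_bij_betw [OF \<phi>, of \<omega>] sum_fourier_weight[OF p0] by (simp add: \<omega>_def)
  moreover have "0 \<le> \<omega> (\<phi> b) \<and> \<omega> (\<phi> b) \<le> 1" if "b \<in> {1..<p}" for b
    using \<omega> bij_betw_apply[OF \<phi> that] by blast
  ultimately show thesis
    by (intro that[of "\<lambda>b. \<omega> (\<phi> b)"])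
qed

text \<open>Congruences with explicit positions \<open>x\<close> are what the Fourier and covering
  arguments work with, and this form is visibly inherited by subsets.\<close>

definition in_AP_mod :: "int set \<Rightarrow> nat \<Rightarrow> nat \<Rightarrow> bool" where
  "in_AP_mod B p L \<longleftrightarrow>
     (\<exists>a d. \<not> [d = 0] (mod int p) \<and> (\<forall>n\<in>B. \<exists>x<L. [n = a + int x * d] (mod int p)))"

text \<open>The weighted sum \<open>V\<close> of squared coefficients at all \<open>b / p\<close> is
  bounded below by the progressions and above through the energy. The fractions are spaced with
  \<open>K\<close> the square of \<open>Q\<close>, at most \<open>N\<close>, so the large sieve
  loses only logarithms.\<close>

lemma energy_lower_bound:
  fixes \<epsilon> :: real
  assumes B: "B \<subseteq> {1..int N}" and "0 < \<epsilon>" "0 < Q" "Q\<^sup>2 \<le> N"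
    and AP: "\<And>p. prime p \<Longrightarrow> p \<le> Q \<Longrightarrow> \<exists>L. in_AP_mod B p L \<and> real L \<le> (1 - \<epsilon>) * real p"
  shows "real (card {p. prime p \<and> p \<le> Q}) * (\<epsilon> * card B) ^ 4 \<le>
    real (energy B N) * (2 * real N + 1 + real N * harm N) * harm Q ^ 3"
proof (cases "card {p. prime p \<and> p \<le> Q} = 0")
  case False
  define P where "P = {p. prime p \<and> p \<le> Q}"
  define H where "H = (harm Q :: real)"
  define \<Delta> where "\<Delta> = 2 * real N + 1 + real N * harm N"
  define f where "f p b = (norm (\<Sum>n\<in>B. e2pi (of_int n * (real b / real p))))\<^sup>2" for p b
  have finB: "finite B" using B finite_subset by blast
  have finP: "finite P" by (simp add: P_def)
  have H: "H > 0" using \<open>0 < Q\<close> by (simp add: H_def harm_pos)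
  have "\<exists>w. (\<forall>b\<in>{1..<p}. 0 \<le> w b \<and> w b \<le> 1) \<and> sum w {1..<p} \<le> H \<and>
      (\<epsilon> * card B)\<^sup>2 \<le> H * (\<Sum>b\<in>{1..<p}. w b * f p b)" if "p \<in> P" for p
  proof -
    have pQ: "prime p" "p \<le> Q" using that by (auto simp: P_def)
    obtain L where L: "in_AP_mod B p L" "real L \<le> (1 - \<epsilon>) * real p"
      using AP[OF pQ] by blast
    obtain a d x where d: "\<not> [d = 0] (mod int p)"
      and x: "\<And>n. n \<in> B \<Longrightarrow> x n < L \<and> [n = a + int (x n) * d] (mod int p)"
      using L(1) unfolding in_AP_mod_def by metis
    obtain w :: "nat \<Rightarrow> real" where w: "\<And>b. b \<in> {1..<p} \<Longrightarrow> 0 \<le> w b \<and> w b \<le> 1"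
      "sum w {1..<p} = harm (p - 1)" "(\<epsilon> * card B)\<^sup>2 \<le> harm (p - 1) * (\<Sum>b\<in>{1..<p}. w b * f p b)"
      using fourier_of_progression[OF pQ(1) d finB \<open>0 < \<epsilon>\<close> L(2) x] unfolding f_def by blast
    have "harm (p - 1) \<le> H"
      unfolding H_def using pQ by (intro harm_mono) auto
    moreover have "harm (p - 1) * (\<Sum>b\<in>{1..<p}. w b * f p b) \<le> H * (\<Sum>b\<in>{1..<p}. w b * f p b)"
      using w(1) \<open>harm (p - 1) \<le> H\<close> by (intro mult_right_mono sum_nonneg mult_nonneg_nonneg) (auto simp: f_def)
    ultimately show ?thesis using w by (intro exI[of _ w]) auto
  qed
  then obtain w where w: "\<And>p b. p \<in> P \<Longrightarrow> b \<in> {1..<p} \<Longrightarrow> 0 \<le> w p b \<and> w p b \<le> (1::real)"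
    "\<And>p. p \<in> P \<Longrightarrow> sum (w p) {1..<p} \<le> H"
    "\<And>p. p \<in> P \<Longrightarrow> (\<epsilon> * card B)\<^sup>2 \<le> H * (\<Sum>b\<in>{1..<p}. w p b * f p b)"
    by metis
  define I where "I = (SIGMA p:P. {1..<p})"
  define V where "V = (\<Sum>(p, b)\<in>I. w p b * f p b)"
  have V: "V = (\<Sum>p\<in>P. \<Sum>b\<in>{1..<p}. w p b * f p b)"
    unfolding V_def I_def using finP by (subst sum.Sigma) auto
  have "real (card P) * (\<epsilon> * card B)\<^sup>2 \<le> (\<Sum>p\<in>P. H * (\<Sum>b\<in>{1..<p}. w p b * f p b))"
    using sum_mono[of P "\<lambda>_. (\<epsilon> * card B)\<^sup>2"] w(3) by simp
  also have "\<dots> = H * V"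
    by (simp add: V sum_distrib_left)
  finally have HV: "real (card P) * (\<epsilon> * card B)\<^sup>2 \<le> H * V" .
  \<comment> \<open>As the weights are at most 1, their squares are bounded by the weights, whose
    sum is at most \<open>H\<close> for each prime.\<close>
  have sq: "(\<Sum>(p, b)\<in>I. (w p b)\<^sup>2) \<le> real (card P) * H"
  proof -
    have "(\<Sum>(p, b)\<in>I. (w p b)\<^sup>2) \<le> (\<Sum>(p, b)\<in>I. w p b)"
      using w(1) by (intro sum_mono) (auto simp: I_def power2_eq_square mult_left_le)
    also have "\<dots> = (\<Sum>p\<in>P. sum (w p) {1..<p})"
      unfolding I_def using finP by (subst sum.Sigma) auto
    also have "\<dots> \<le> (\<Sum>p\<in>P. H)"
      using w(2) by (rule sum_mono)
    finally show ?thesis by simp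
  qed
  have "real N \<ge> real (Q\<^sup>2)" using \<open>Q\<^sup>2 \<le> N\<close> by (rule of_nat_mono)
  then have K: "2 * real N + 1 + real (Q\<^sup>2) * harm (Q\<^sup>2) \<le> \<Delta>"
    unfolding \<Delta>_def using \<open>Q\<^sup>2 \<le> N\<close> by (intro add_mono mult_mono harm_mono harm_nonneg) auto
  have sp: "spaced I (\<lambda>(p, b). real b / real p) (Q\<^sup>2)"
    unfolding I_def by (rule spaced_fractions) (simp add: P_def)
  have "V\<^sup>2 = (\<Sum>i\<in>I. (case i of (p, b) \<Rightarrow> w p b) * (norm (\<Sum>n\<in>B. e2pi (of_int n * (case i of (p, b) \<Rightarrow> real b / real p))))\<^sup>2)\<^sup>2"
    unfolding V_def f_def by (simp add: case_prod_unfold)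
  also have "\<dots> \<le> real (energy B N) * ((2 * real N + 1 + real (Q\<^sup>2) * harm (Q\<^sup>2)) *
      (\<Sum>i\<in>I. (case i of (p, b) \<Rightarrow> w p b)\<^sup>2))"
    using finP \<open>0 < Q\<close> by (intro fourier_energy_bound[OF B _ sp]) (auto simp: I_def)
  also have "\<dots> \<le> real (energy B N) * (\<Delta> * (real (card P) * H))"
    using sq K H by (intro mult_left_mono mult_mono) (auto simp: case_prod_unfold \<Delta>_def harm_nonneg intro!: sum_nonneg)
  finally have V2: "V\<^sup>2 \<le> real (energy B N) * \<Delta> * (real (card P) * H)" by simp
  have "(real (card P) * (\<epsilon> * card B)\<^sup>2)\<^sup>2 \<le> (H * V)\<^sup>2"
    using HV by (intro power_mono) auto
  also have "\<dots> \<le> H\<^sup>2 * (real (energy B N) * \<Delta> * (real (card P) * H))"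
    unfolding power_mult_distrib using V2 by (intro mult_left_mono) auto
  \<comment> \<open>Both sides carry a factor \<open>card P\<close>; it can be cancelled because the
    case without primes is treated apart.\<close>
  finally have "real (card P) * (real (card P) * (\<epsilon> * card B) ^ 4) \<le>
      real (card P) * (real (energy B N) * \<Delta> * H ^ 3)"
    by (simp add: power_mult_distrib power2_eq_square power3_eq_cube power4_eq_xxxx algebra_simps)
  moreover have "card P > 0"
    using False unfolding P_def by linarith
  ultimately show ?thesis
    by (simp add: P_def \<Delta>_def H_def)
next
  case True
  show ?thesis unfolding True by (simp add: harm_nonneg)
qed

section \<open>Gallagher's larger sieve in terms of collisions\<close>

section \<open>The larger sieve\<close>

definition collisions :: "int set \<Rightarrow> nat \<Rightarrow> nat" where
  "collisions S p = card {(x, y) \<in> S \<times> S. [x = y] (mod int p)}"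

text \<open>By Cauchy--Schwarz this is a lower bound for the density of the residues of \<open>S\<close> modulo \<open>p\<close>. Unlike
  that density, it is stable under deleting a small part of \<open>S\<close>.\<close>

definition eff_density :: "int set \<Rightarrow> nat \<Rightarrow> real" where
  "eff_density S p = (real (card S))\<^sup>2 / (real p * real (collisions S p))"

text \<open>Cauchy-Schwarz over the fibres of \<open>g\<close>: the number of colliding pairs is the
  sum of the squared fibre sizes.\<close>

lemma card_squared_le_fibres:
  assumes "finite S" "finite U" "g ` S \<subseteq> U"
  shows "(card S)\<^sup>2 \<le> card U * card {(x, y) \<in> S \<times> S. g x = g y}"
proof -
  define c where "c u = card {x \<in> S. g x = u}" for u
  have "card S = (\<Sum>u\<in>U. c u)"
    using card_eq_sum sum.group[OF assms, of "\<lambda>_. 1::nat"] by (simp add: c_def)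
  then have "(real (card S))\<^sup>2 = (\<Sum>u\<in>U. 1 * real (c u))\<^sup>2"
    by simp
  also have "\<dots> \<le> (\<Sum>u\<in>U. 1\<^sup>2) * (\<Sum>u\<in>U. (real (c u))\<^sup>2)"
    by (rule Cauchy_Schwarz_ineq_sum)
  also have "\<dots> = real (card U * (\<Sum>u\<in>U. (c u)\<^sup>2))"
    by simp
  also have "(\<Sum>u\<in>U. (c u)\<^sup>2) = card (SIGMA x:S. {y \<in> S. g y = g x})"
  proof -
    have "card (SIGMA x:S. {y \<in> S. g y = g x}) = (\<Sum>x\<in>S. c (g x))"
      using assms by (simp add: c_def)
    also have "\<dots> = (\<Sum>u\<in>U. \<Sum>x | x \<in> S \<and> g x = u. c (g x))"
      by (rule sum.group[OF assms, symmetric])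
    also have "\<dots> = (\<Sum>u\<in>U. (c u)\<^sup>2)"
      by (rule sum.cong [OF refl]) (simp add: c_def power2_eq_square)
    finally show ?thesis by simp
  qed
  also have "(SIGMA x:S. {y \<in> S. g y = g x}) = {(x, y) \<in> S \<times> S. g x = g y}"
    by auto
  finally show ?thesis
    by (simp flip: of_nat_power of_nat_mult)
qed

lemma card_squared_le_collisions:
  assumes "finite S" "finite U" "g ` S \<subseteq> U"
    and "\<And>x y. x \<in> S \<Longrightarrow> y \<in> S \<Longrightarrow> g x = g y \<Longrightarrow> [x = y] (mod int p)"
  shows "(card S)\<^sup>2 \<le> card U * collisions S p"
proof -
  have "card {(x, y) \<in> S \<times> S. g x = g y} \<le> collisions S p"
    unfolding collisions_def using assms(1,4)
    by (intro card_mono) (auto intro: finite_subset[of _ "S \<times> S"])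
  then show ?thesis
    using card_squared_le_fibres[OF assms(1-3)] by (meson le_trans mult_le_mono2)
qed

lemma collisions_pos:
  assumes "finite S" "S \<noteq> {}"
  shows "collisions S p > 0"
proof -
  obtain x where "x \<in> S" using assms by blast
  then have "(x, x) \<in> {(x, y) \<in> S \<times> S. [x = y] (mod int p)}" by simp
  moreover have "finite {(x, y) \<in> S \<times> S. [x = y] (mod int p)}"
    using assms by (auto intro: finite_subset[of _ "S \<times> S"])
  ultimately show ?thesis
    unfolding collisions_def card_gt_0_iff by blast
qed

text \<open>The labels \<open>g\<close> only have to determine the residue. They are later positions
  in a progression or dilated residues.\<close>

lemma eff_density_le:
  assumes "finite S" "finite U" "g ` S \<subseteq> U" "p > 0"
    and "\<And>x y. x \<in> S \<Longrightarrow> y \<in> S \<Longrightarrow> g x = g y \<Longrightarrow> [x = y] (mod int p)"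
  shows "eff_density S p \<le> card U / real p"
proof (cases "S = {}")
  case False
  have "(card S)\<^sup>2 \<le> card U * collisions S p"
    using assms(1-3,5) by (rule card_squared_le_collisions)
  then have "(real (card S))\<^sup>2 \<le> real (card U) * real (collisions S p)"
    by (simp flip: of_nat_power of_nat_mult)
  moreover have "collisions S p > 0" using assms(1) False by (rule collisions_pos)
  ultimately show ?thesis
    using \<open>p > 0\<close> by (simp add: eff_density_def field_simps)
qed (simp add: eff_density_def)

lemma eff_density_nonneg [simp]: "0 \<le> eff_density S p"
  by (simp add: eff_density_def)

text \<open>Distinct primes dividing \<open>k\<close> are coprime, so their product divides
  \<open>k\<close> as well.\<close>

lemma sum_ln_prime_divisors_le:
  fixes k :: int
  assumes "k \<noteq> 0" "finite P" "\<And>p. p \<in> P \<Longrightarrow> prime p \<and> int p dvd k"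
  shows "(\<Sum>p\<in>P. ln (real p)) \<le> ln \<bar>real_of_int k\<bar>"
proof -
  have "\<Prod>P dvd nat \<bar>k\<bar>"
    using assms(2,3)
  proof (induction P)
    case (insert p P)
    have "coprime p (\<Prod>P)"
      using insert by (intro prod_coprime_right) (metis insertI1 insertI2 primes_coprime)
    moreover have "p dvd nat \<bar>k\<bar>"
      using insert.prems[of p] by (simp add: dvd_nat_abs_iff)
    moreover have "\<Prod>P dvd nat \<bar>k\<bar>"
      using insert by blast
    ultimately have "p * \<Prod>P dvd nat \<bar>k\<bar>"
      by (intro divides_mult)
    then show ?case
      unfolding prod.insert[OF insert.hyps] .
  qed simp
  then have "\<Prod>P \<le> nat \<bar>k\<bar>"
    using assms(1) by (intro dvd_imp_le) auto
  then have "real (\<Prod>P) \<le> \<bar>real_of_int k\<bar>"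
    by linarith
  moreover have "real (\<Prod>P) > 0"
    using assms(3) prime_gt_0_nat by (metis of_nat_0_less_iff prod_pos)
  ultimately have "ln (real (\<Prod>P)) \<le> ln \<bar>real_of_int k\<bar>"
    by (rule ln_mono)
  moreover have "ln (real (\<Prod>P)) = (\<Sum>p\<in>P. ln (real p))"
    unfolding of_nat_prod using assms(2,3) prime_gt_0_nat by (intro ln_prod) (metis less_irrefl of_nat_0_less_iff)+
  ultimately show ?thesis by simp
qed

text \<open>Triples \<open>p\<close>, \<open>x\<close>, \<open>y\<close> with \<open>p\<close>
  dividing \<open>x - y\<close> are counted with weight \<open>ln p\<close>. For
  \<open>x \<noteq> y\<close> the primes dividing \<open>x - y\<close> weigh at most
  \<open>ln D\<close>; each diagonal pair receives all primes.\<close>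

lemma larger_sieve:
  fixes S :: "int set" and D :: real
  assumes S: "finite S" and P: "finite P" "\<And>p. p \<in> P \<Longrightarrow> prime p"
    and D: "D \<ge> 1" "\<And>x y. x \<in> S \<Longrightarrow> y \<in> S \<Longrightarrow> \<bar>x - y\<bar> \<le> D"
  shows "(\<Sum>p\<in>P. ln (real p) * collisions S p) \<le>
    (real (card S))\<^sup>2 * ln D + card S * (\<Sum>p\<in>P. ln (real p))"
proof -
  define \<theta> where "\<theta> = (\<Sum>p\<in>P. ln (real p))"
  have coll: "real (collisions S p) = (\<Sum>x\<in>S. \<Sum>y\<in>S. if [x = y] (mod int p) then 1 else 0)" for p
  proof -
    have "{(x, y) \<in> S \<times> S. [x = y] (mod int p)} = (SIGMA x:S. {y \<in> S. [x = y] (mod int p)})"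
      by auto
    then show ?thesis
      using S by (simp add: collisions_def sum.If_cases Int_def)
  qed
  have "(\<Sum>p\<in>P. ln (real p) * collisions S p) =
      (\<Sum>p\<in>P. \<Sum>x\<in>S. \<Sum>y\<in>S. if [x = y] (mod int p) then ln (real p) else 0)"
    unfolding coll sum_distrib_left by (intro sum.cong refl) simp
  also have "\<dots> = (\<Sum>x\<in>S. \<Sum>y\<in>S. \<Sum>p\<in>P. if [x = y] (mod int p) then ln (real p) else 0)"
    by (subst sum.swap, rule sum.cong [OF refl], rule sum.swap)
  also have "\<dots> = (\<Sum>x\<in>S. \<Sum>y\<in>S. \<Sum>p | p \<in> P \<and> [x = y] (mod int p). ln (real p))"
    using P by (simp add: sum.inter_filter)
  also have "\<dots> \<le> (\<Sum>x\<in>S. \<Sum>y\<in>S. ln D + (if x = y then \<theta> else 0))"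
  proof (intro sum_mono)
    fix x y assume xy: "x \<in> S" "y \<in> S"
    show "(\<Sum>p | p \<in> P \<and> [x = y] (mod int p). ln (real p)) \<le> ln D + (if x = y then \<theta> else 0)"
    proof (cases "x = y")
      case False
      have "(\<Sum>p | p \<in> P \<and> [x = y] (mod int p). ln (real p)) \<le> ln \<bar>real_of_int (x - y)\<bar>"
        using False P by (intro sum_ln_prime_divisors_le) (auto simp: cong_iff_dvd_diff)
      also have "\<dots> \<le> ln D"
        using D(2)[OF xy] False by (intro ln_mono) auto
      finally show ?thesis using False by simp
    qed (use D in \<open>simp add: \<theta>_def\<close>)
  qed
  also have "\<dots> = (\<Sum>x\<in>S. real (card S) * ln D + \<theta>)"
    using S by (intro sum.cong) (simp_all add: sum.distrib)
  also have "\<dots> = (real (card S))\<^sup>2 * ln D + card S * \<theta>"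
    by (simp add: power2_eq_square algebra_simps)
  finally show ?thesis by (simp add: \<theta>_def)
qed

text \<open>The larger sieve bounds the weighted sum of \<open>1 / eff_density\<close> by
  \<open>ln D + 1\<close>, and Cauchy-Schwarz turns this into a lower bound for the mean density.
  For primes up to almost the square root of \<open>D\<close>, \<open>\<beta>\<close> can be taken
  close to \<open>1 / 2\<close>.\<close>

lemma sum_eff_density_ge:
  fixes S :: "int set" and D \<beta> :: real
  assumes S: "finite S" "S \<noteq> {}" and P: "finite P" "\<And>p. p \<in> P \<Longrightarrow> prime p"
    and D: "D \<ge> 1" "\<And>x y. x \<in> S \<Longrightarrow> y \<in> S \<Longrightarrow> \<bar>x - y\<bar> \<le> D"
    and large: "(\<Sum>p\<in>P. ln (real p)) \<le> card S"
    and \<beta>: "\<beta> * (ln D + 1) \<le> (\<Sum>p\<in>P. ln (real p) / real p)"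
  shows "\<beta> * (\<Sum>p\<in>P. ln (real p) / real p) \<le> (\<Sum>p\<in>P. ln (real p) / real p * eff_density S p)"
proof -
  define \<Lambda> where "\<Lambda> = (\<Sum>p\<in>P. ln (real p) / real p)"
  define wt where "wt p = ln (real p) / real p" for p :: nat
  have cardS: "real (card S) > 0" using S by (simp add: card_gt_0_iff)
  have wt: "wt p \<ge> 0" if "p \<in> P" for p
    using P(2)[OF that] prime_ge_1_nat[of p] by (simp add: wt_def)
  have s: "eff_density S p > 0" if "p \<in> P" for p
    using cardS collisions_pos[OF S, of p] P(2)[OF that, THEN prime_gt_0_nat] by (simp add: eff_density_def)
  have quot: "wt p / eff_density S p = ln (real p) * collisions S p / (real (card S))\<^sup>2" if "p \<in> P" for p
    using P(2)[OF that, THEN prime_gt_0_nat] by (simp add: eff_density_def wt_def)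
  have "(\<Sum>p\<in>P. wt p / eff_density S p) = (\<Sum>p\<in>P. ln (real p) * collisions S p) / (real (card S))\<^sup>2"
    unfolding sum_divide_distrib by (rule sum.cong) (auto simp: quot)
  also have "\<dots> \<le> ((real (card S))\<^sup>2 * ln D + card S * (\<Sum>p\<in>P. ln (real p))) / (real (card S))\<^sup>2"
    by (intro divide_right_mono larger_sieve S P D) auto
  also have "\<dots> \<le> ((real (card S))\<^sup>2 * ln D + card S * real (card S)) / (real (card S))\<^sup>2"
    using large by (intro divide_right_mono add_left_mono mult_left_mono) auto
  also have "\<dots> = ln D + 1"
    using cardS by (simp add: power2_eq_square field_simps)
  finally have inv: "(\<Sum>p\<in>P. wt p / eff_density S p) \<le> ln D + 1" .
  have "\<Lambda>\<^sup>2 = (\<Sum>p\<in>P. sqrt (wt p * eff_density S p) * sqrt (wt p / eff_density S p))\<^sup>2"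
  proof -
    have "sqrt (wt p * eff_density S p) * sqrt (wt p / eff_density S p) = wt p" if "p \<in> P" for p
      using s[OF that] wt[OF that] by (simp flip: real_sqrt_mult)
    then show ?thesis by (simp add: \<Lambda>_def wt_def)
  qed
  also have "\<dots> \<le> (\<Sum>p\<in>P. (sqrt (wt p * eff_density S p))\<^sup>2) * (\<Sum>p\<in>P. (sqrt (wt p / eff_density S p))\<^sup>2)"
    by (rule Cauchy_Schwarz_ineq_sum)
  also have "\<dots> = (\<Sum>p\<in>P. wt p * eff_density S p) * (\<Sum>p\<in>P. wt p / eff_density S p)"
    using wt by (intro arg_cong2[of _ _ _ _ "(*)"] sum.cong) auto
  also have "\<dots> \<le> (\<Sum>p\<in>P. wt p * eff_density S p) * (ln D + 1)"
    using inv wt by (intro mult_left_mono sum_nonneg mult_nonneg_nonneg) auto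
  finally have main: "\<Lambda>\<^sup>2 \<le> (\<Sum>p\<in>P. wt p * eff_density S p) * (ln D + 1)" .
  have "\<Lambda> \<ge> 0" using wt by (auto simp: \<Lambda>_def wt_def intro: sum_nonneg)
  then have "\<beta> * \<Lambda> * (ln D + 1) \<le> \<Lambda>\<^sup>2"
    using mult_right_mono[OF \<beta>, of \<Lambda>] by (simp add: \<Lambda>_def power2_eq_square algebra_simps)
  with main have "\<beta> * \<Lambda> * (ln D + 1) \<le> (\<Sum>p\<in>P. wt p * eff_density S p) * (ln D + 1)"
    by linarith
  moreover have "ln D + 1 > 0" using D(1) by (smt (verit) ln_ge_zero)
  ultimately show ?thesis
    by (simp add: \<Lambda>_def wt_def)
qed

section \<open>Sumsets with an interval and the covering estimate\<close>

section \<open>Covering residues by translates of the gap\<close>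

text \<open>The translate of \<open>X\<close> by \<open>a\<close> and the numbers
  \<open>Max X + t\<close> with \<open>a < t \<le> b\<close> are disjoint parts of the
  sumset.\<close>

lemma card_add_interval_ge:
  fixes X :: "nat set"
  assumes "finite X" "X \<noteq> {}" "a \<le> b"
  shows "card X + (b - a) \<le> card {u + t |u t. u \<in> X \<and> t \<in> {a..b}}"
proof -
  let ?Y = "{u + t |u t. u \<in> X \<and> t \<in> {a..b}}"
  have "?Y = (\<lambda>(u, t). u + t) ` (X \<times> {a..b})" by (auto, blast)
  then have fin: "finite ?Y" using assms by simp
  have sub: "(\<lambda>u. u + a) ` X \<union> (\<lambda>t. Max X + t) ` {a<..b} \<subseteq> ?Y"
  proof (intro Un_least image_subsetI)
    show "u + a \<in> ?Y" if "u \<in> X" for u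
      using that assms by (intro CollectI exI[of _ u] exI[of _ a]) auto
    show "Max X + t \<in> ?Y" if "t \<in> {a<..b}" for t
      using that Max_in[OF assms(1,2)] by (intro CollectI exI[of _ "Max X"] exI[of _ t]) auto
  qed
  have "(\<lambda>u. u + a) ` X \<inter> (\<lambda>t. Max X + t) ` {a<..b} = {}"
    using Max_ge[OF assms(1)] by fastforce
  then have "card ((\<lambda>u. u + a) ` X \<union> (\<lambda>t. Max X + t) ` {a<..b}) = card X + (b - a)"
    using assms by (subst card_Un_disjoint) (auto simp: card_image inj_on_def)
  with card_mono [OF fin sub] show ?thesis by simp
qed

lemma mod_in_gap:
  fixes y :: int
  assumes "- (p - L) \<le> y" "y \<le> - 1" "0 \<le> L" "L \<le> p"
  shows "L \<le> y mod p"
proof -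
  have "y mod p = (y + p) mod p" by simp
  also have "\<dots> = y + p" using assms by (intro mod_pos_pos_trivial) auto
  finally show ?thesis using assms by linarith
qed

text \<open>At most \<open>card C\<close> cells are light, and each holds fewer than
  \<open>\<eta> * card S\<close> elements.\<close>

lemma frequent_cells:
  fixes S :: "'a set" and \<eta> :: real
  assumes "finite S" "finite C" "c ` S \<subseteq> C" "0 \<le> \<eta>"
  shows "(1 - card C * \<eta>) * card S \<le> card {n\<in>S. \<eta> * card S \<le> card {n'\<in>S. c n' = c n}}"
proof -
  define light where "light = {u\<in>C. card {n\<in>S. c n = u} < \<eta> * card S}"
  define heavy where "heavy = {n\<in>S. \<eta> * card S \<le> card {n'\<in>S. c n' = c n}}"
  have fin: "finite light" using assms by (simp add: light_def)
  have "card (\<Union>u\<in>light. {n\<in>S. c n = u}) \<le> (\<Sum>u\<in>light. card {n\<in>S. c n = u})"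
    using fin by (rule card_UN_le)
  then have "real (card (\<Union>u\<in>light. {n\<in>S. c n = u})) \<le> (\<Sum>u\<in>light. real (card {n\<in>S. c n = u}))"
    unfolding of_nat_sum [symmetric] of_nat_le_iff .
  also have "\<dots> \<le> (\<Sum>u\<in>light. \<eta> * card S)"
    by (intro sum_mono) (auto simp: light_def)
  also have "\<dots> = card light * (\<eta> * card S)" by simp
  also have "\<dots> \<le> card C * (\<eta> * card S)"
    using assms by (intro mult_right_mono) (auto intro!: card_mono simp: light_def)
  finally have light: "real (card (\<Union>u\<in>light. {n\<in>S. c n = u})) \<le> card C * (\<eta> * card S)" .
  have "S \<subseteq> heavy \<union> (\<Union>u\<in>light. {n\<in>S. c n = u})"
    using assms by (auto simp: heavy_def light_def)
  then have "card S \<le> card (heavy \<union> (\<Union>u\<in>light. {n\<in>S. c n = u}))"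
    using assms fin by (intro card_mono) (auto simp: heavy_def)
  also have "\<dots> \<le> card heavy + card (\<Union>u\<in>light. {n\<in>S. c n = u})"
    by (rule card_Un_le)
  finally have "real (card S) \<le> card heavy + card (\<Union>u\<in>light. {n\<in>S. c n = u})"
    by linarith
  with light show ?thesis by (simp add: heavy_def algebra_simps)
qed

text \<open>If \<open>k\<close> elements are drawn independently from \<open>S\<close>, the expected density of the residues \<open>z\<close>
  with all of them in \<open>z + {0..<L}\<close> is the first term. It is small because the gap of length
  \<open>p - L\<close> of the progression, translated by the sample, covers about as many residues as \<open>S\<close>
  occupies plus \<open>p - L\<close>.\<close>

lemma expected_uncovered_density:
  fixes S :: "int set" and \<epsilon> :: real
  assumes S: "finite S" "S \<noteq> {}" and \<epsilon>: "0 < \<epsilon>" "\<epsilon> \<le> 1"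
    and L: "real L \<le> (1 - \<epsilon>) * real p" and p: "8 / \<epsilon> \<le> real p"
    and x: "\<And>n. n \<in> S \<Longrightarrow> x n < L"
    and xc: "\<And>m n. m \<in> S \<Longrightarrow> n \<in> S \<Longrightarrow> x m = x n \<Longrightarrow> [m = n] (mod int p)"
    and k: "(1 - \<epsilon>\<^sup>2 / 144) ^ k \<le> \<epsilon> / 8"
  shows "(\<Sum>z<p. (card {n\<in>S. (int (x n) - int z) mod int p < int L} / card S) ^ k) / p
    + eff_density S p \<le> 1 - \<epsilon> / 4"
proof -
  define V where "V z = {n\<in>S. (int (x n) - int z) mod int p < int L}" for z
  \<comment> \<open>There are at most \<open>9 / \<epsilon>\<close> cells of length
    \<open>l\<close>, so light cells lose at most the proportion
    \<open>9 / \<epsilon> * \<eta> = \<epsilon> / 16\<close> of \<open>S\<close>.\<close>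
  define \<eta> where "\<eta> = \<epsilon>\<^sup>2 / 144"
  define l where "l = nat \<lfloor>\<epsilon> * p / 4\<rfloor>"
  define c where "c n = x n div l" for n
  define S1 where "S1 = {n\<in>S. \<eta> * card S \<le> card {n'\<in>S. c n' = c n}}"
  define X where "X = x ` S1"
  \<comment> \<open>The gap is shortened by \<open>l\<close> at both ends. A residue
    \<open>z\<close> in \<open>Y\<close> is then excluded not only by one element of
    \<open>S1\<close> but by all elements in its cell.\<close>
  define Y where "Y = {u + t |u t. u \<in> X \<and> t \<in> {l..p - L - l}}"
  have p0: "real p > 0" using p \<epsilon> by (smt (verit) divide_pos_pos)
  have \<epsilon>p: "\<epsilon> * p \<ge> 8" using p \<epsilon> by (simp add: field_simps)
  have l: "real l \<le> \<epsilon> * p / 4" "real l \<ge> \<epsilon> * p / 8" "l > 0"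
    using \<epsilon>p unfolding l_def by linarith+
  have Lp: "real p - real L \<ge> \<epsilon> * p" using L by (simp add: algebra_simps)
  then have gap: "4 * l \<le> p - L" "L < p" using l \<epsilon>p by linarith+
  have cardS: "real (card S) > 0" using S by (simp add: card_gt_0_iff)
  have fin1: "finite S1" using S by (simp add: S1_def)

  have cells: "c ` S \<subseteq> {..p div l}"
  proof (rule image_subsetI)
    fix n assume "n \<in> S"
    then have "x n \<le> p" using x[of n] gap(2) by linarith
    then show "c n \<in> {..p div l}" unfolding c_def atMost_iff by (rule div_le_mono)
  qed
  have "real (p div l) \<le> real p / real l" by (rule of_nat_div_le_of_nat)
  also have "\<dots> \<le> real p / (\<epsilon> * p / 8)" using l \<epsilon> p0 by (intro divide_left_mono) auto
  also have "\<dots> = 8 / \<epsilon>" using p0 by simp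
  finally have "real (card {..p div l}) \<le> 8 / \<epsilon> + 1 / \<epsilon>"
    using \<epsilon> by (simp add: field_simps)
  then have "real (card {..p div l}) * \<eta> \<le> 9 / \<epsilon> * \<eta>"
    by (intro mult_right_mono) (auto simp: \<eta>_def)
  also have "\<dots> = \<epsilon> / 16" using \<epsilon> by (simp add: \<eta>_def power2_eq_square)
  finally have "(1 - \<epsilon> / 16) * card S \<le> (1 - card {..p div l} * \<eta>) * card S"
    by (intro mult_right_mono) auto
  also have "\<dots> \<le> card S1"
    unfolding S1_def using S by (intro frequent_cells cells) (auto simp: \<eta>_def)
  finally have S1: "(1 - \<epsilon> / 16) * card S \<le> card S1" .
  moreover have "0 < (1 - \<epsilon> / 16) * card S" using \<epsilon> cardS by (intro mult_pos_pos) auto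
  ultimately have "S1 \<noteq> {}" by force

  have s1: "eff_density S p \<le> 1"
  proof -
    have "eff_density S p \<le> card {..<L} / p"
      using S x xc p0 by (intro eff_density_le[where g = x]) auto
    also have "\<dots> \<le> 1" using gap p0 by simp
    finally show ?thesis .
  qed
  \<comment> \<open>Passing to \<open>S1\<close> does not increase the collisions and costs at most
    a factor \<open>1 - \<epsilon> / 16\<close> in the cardinality, hence little in the
    density.\<close>
  have X_ge: "eff_density S p - \<epsilon> / 8 \<le> card X / p"
  proof -
    have "(card S1)\<^sup>2 \<le> card X * collisions S1 p"
      using fin1 xc by (intro card_squared_le_collisions[where g = x]) (auto simp: X_def S1_def)
    also have "collisions S1 p \<le> collisions S p"
      unfolding collisions_def using S by (intro card_mono) (auto simp: S1_def intro: finite_subset[of _ "S \<times> S"])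
    finally have "(card S1)\<^sup>2 \<le> card X * collisions S p" by simp
    then have sq: "(real (card S1))\<^sup>2 \<le> real (card X) * collisions S p"
      by (simp flip: of_nat_power of_nat_mult)
    have "(1 - \<epsilon> / 8) * (real (card S))\<^sup>2 \<le> ((1 - \<epsilon> / 16) * card S)\<^sup>2"
      unfolding power_mult_distrib by (intro mult_right_mono) (auto simp: power2_eq_square algebra_simps)
    also have "\<dots> \<le> (real (card S1))\<^sup>2"
      using S1 \<epsilon> by (intro power_mono) auto
    finally have "(1 - \<epsilon> / 8) * (real (card S))\<^sup>2 \<le> real (card X) * collisions S p"
      using sq by linarith
    then have "(1 - \<epsilon> / 8) * (real (card S))\<^sup>2 / (p * collisions S p) \<le>
        real (card X) * collisions S p / (p * collisions S p)"
      by (intro divide_right_mono) auto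
    then have "(1 - \<epsilon> / 8) * eff_density S p \<le> card X / p"
      using collisions_pos[OF S, of p] by (simp add: eff_density_def)
    moreover have "\<epsilon> / 8 * eff_density S p \<le> \<epsilon> / 8 * 1"
      using s1 \<epsilon> by (intro mult_left_mono) auto
    ultimately show ?thesis by (simp add: algebra_simps)
  qed

  have XL: "u < L" if "u \<in> X" for u
    using that x by (auto simp: X_def S1_def)
  have "card X + (p - L - l - l) \<le> card Y"
    unfolding Y_def using fin1 \<open>S1 \<noteq> {}\<close> gap by (intro card_add_interval_ge) (auto simp: X_def)
  then have "real (card X) + (real p - real L - 2 * real l) \<le> card Y"
    using gap by linarith
  then have Y_ge: "real (card X) + \<epsilon> * p / 2 \<le> card Y"
    using Lp l(1) by linarith
  have Yp: "Y \<subseteq> {..<p}"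
    using XL gap l by (fastforce simp: Y_def)
  \<comment> \<open>A residue in \<open>Y\<close> is excluded by a whole heavy cell, that is, with
    probability at least \<open>\<eta>\<close> in each draw.\<close>
  have V_le: "card (V y) / card S \<le> (if y \<in> Y then 1 - \<eta> else 1)" for y
  proof (cases "y \<in> Y")
    case True
    then obtain n t where nt: "n \<in> S1" "y = x n + t" "l \<le> t" "t \<le> p - L - l"
      by (auto simp: Y_def X_def)
    have "V y \<inter> {n'\<in>S. c n' = c n} = {}"
    proof (rule ccontr)
      assume "V y \<inter> {n'\<in>S. c n' = c n} \<noteq> {}"
      then obtain n' where n': "n' \<in> V y" "n' \<in> S" "x n' div l = x n div l"
        by (auto simp: c_def)
      have "x n' = x n div l * l + x n' mod l" "x n = x n div l * l + x n mod l"
        using div_mult_mod_eq[of "x n'" l] n'(3) by simp_all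
      moreover have "x n' mod l < l" "x n mod l < l"
        using l(3) by simp_all
      ultimately have "x n' < x n + l" "x n < x n' + l"
        by linarith+
      then have "int L \<le> (int (x n') - int y) mod int p"
        using nt gap by (intro mod_in_gap) auto
      with n' show False by (simp add: V_def)
    qed
    then have "card (V y) + card {n'\<in>S. c n' = c n} = card (V y \<union> {n'\<in>S. c n' = c n})"
      using S by (subst card_Un_disjoint) (auto simp: V_def)
    also have "\<dots> \<le> card S"
      using S by (intro card_mono) (auto simp: V_def)
    finally have "real (card (V y)) + card {n'\<in>S. c n' = c n} \<le> card S"
      by linarith
    then have "card (V y) \<le> (1 - \<eta>) * card S"
      using nt(1) by (simp add: S1_def algebra_simps)
    then show ?thesis using True cardS by (simp add: field_simps)
  next
    case False
    have "card (V y) \<le> card S" using S by (intro card_mono) (auto simp: V_def)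
    then show ?thesis using False cardS by simp
  qed
  have \<eta>1: "0 \<le> 1 - \<eta>" using \<epsilon> by (simp add: \<eta>_def power2_eq_square mult_le_one[THEN order.trans])
  have "(\<Sum>z<p. (card (V z) / card S) ^ k) \<le> (\<Sum>z<p. if z \<in> Y then \<epsilon> / 8 else 1)"
  proof (rule sum_mono)
    fix z
    have "(card (V z) / card S) ^ k \<le> (if z \<in> Y then 1 - \<eta> else 1) ^ k"
      by (intro power_mono V_le) auto
    also have "\<dots> \<le> (if z \<in> Y then \<epsilon> / 8 else 1)"
      using k by (simp add: \<eta>_def)
    finally show "(card (V z) / card S) ^ k \<le> (if z \<in> Y then \<epsilon> / 8 else 1)" .
  qed
  also have "\<dots> = (\<Sum>z\<in>{..<p} \<inter> Y. \<epsilon> / 8) + (\<Sum>z\<in>{..<p} - Y. 1)"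
    by (subst sum.If_cases) (auto simp: Diff_eq)
  also have "\<dots> = card Y * (\<epsilon> / 8) + (real p - card Y)"
    using Yp card_mono[OF _ Yp] by (simp add: Int_absorb1 card_Diff_subset finite_subset of_nat_diff)
  also have "\<dots> \<le> p * (\<epsilon> / 8) + (real p - card Y)"
    using card_mono[OF _ Yp] \<epsilon> by (intro add_right_mono mult_right_mono) auto
  also have "\<dots> \<le> p * (\<epsilon> / 8) + (real p - (card X + \<epsilon> * p / 2))"
    using Y_ge by linarith
  finally have "(\<Sum>z<p. (card (V z) / card S) ^ k) / p \<le> (p * (\<epsilon> / 8) + (real p - (card X + \<epsilon> * p / 2))) / p"
    by (rule divide_right_mono) simp
  \<comment> \<open>The shortened gap gains \<open>\<epsilon> / 2\<close>; the residues of
    \<open>Y\<close> missed after \<open>k\<close> draws cost \<open>\<epsilon> / 8\<close>, and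
    \<open>X_ge\<close> costs another \<open>\<epsilon> / 8\<close>.\<close>
  also have "\<dots> = 1 - 3 / 8 * \<epsilon> - card X / p"
    using p0 by (simp add: field_simps)
  finally show ?thesis
    using X_ge by (simp add: V_def)
qed

section \<open>Popular differences and random tuples\<close>

section \<open>Dependent random choice\<close>

lemma finite_if_subset_initial: "B \<subseteq> {1..int N} \<Longrightarrow> finite B"
  by (rule finite_subset) auto

lemma sum_diff_count_eq:
  assumes "B \<subseteq> {1..int N}"
  shows "(\<Sum>h\<in>{- int N..int N}. real (diff_count B h)) = (real (card B))\<^sup>2"
  using sum_diff_count[OF assms, of "\<lambda>_. 1 :: real"] by (simp add: power2_eq_square)

text \<open>\<open>T\<close> is half the mean of \<open>diff_count\<close> weighted by itself, so
  differences below \<open>T\<close> carry at most half of the energy. On the others every further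
  factor \<open>diff_count\<close> is at least \<open>T\<close>.\<close>

lemma popular_moment_ge:
  fixes T :: real
  assumes B: "B \<subseteq> {1..int N}" "B \<noteq> {}" and T: "T = energy B N / (2 * (real (card B))\<^sup>2)"
  shows "T ^ (k + 1) * (real (card B))\<^sup>2 \<le>
    (\<Sum>h | h \<in> {- int N..int N} \<and> T \<le> diff_count B h. real (diff_count B h) ^ (k + 2))"
proof -
  define H where "H = {h. h \<in> {- int N..int N} \<and> T \<le> diff_count B h}"
  define r where "r h = real (diff_count B h)" for h
  have card: "real (card B) > 0"
    using finite_if_subset_initial[OF B(1)] B(2) by (simp add: card_gt_0_iff)
  have T0: "T \<ge> 0" by (simp add: T)
  have E: "T * (real (card B))\<^sup>2 = energy B N / 2"
    using card by (simp add: T)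
  have finH: "finite H"
    by (rule finite_subset [of _ "{- int N..int N}"]) (auto simp: H_def)
  have "(\<Sum>h\<in>{- int N..int N} - H. (r h)\<^sup>2) \<le> (\<Sum>h\<in>{- int N..int N} - H. T * r h)"
    by (intro sum_mono) (auto simp: H_def r_def power2_eq_square intro!: mult_right_mono)
  also have "\<dots> \<le> (\<Sum>h\<in>{- int N..int N}. T * r h)"
    using T0 by (intro sum_mono2) (auto simp: r_def)
  also have "\<dots> = T * (real (card B))\<^sup>2"
    by (simp add: r_def sum_distrib_left[symmetric] sum_diff_count_eq[OF B(1)])
  finally have "(\<Sum>h\<in>{- int N..int N} - H. (r h)\<^sup>2) \<le> energy B N / 2"
    unfolding E .
  moreover have "(\<Sum>h\<in>{- int N..int N}. (r h)\<^sup>2) = (\<Sum>h\<in>{- int N..int N} - H. (r h)\<^sup>2) + (\<Sum>h\<in>H. (r h)\<^sup>2)"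
    by (rule sum.subset_diff) (auto simp: H_def)
  moreover have "(\<Sum>h\<in>{- int N..int N}. (r h)\<^sup>2) = energy B N"
    by (simp add: energy_def r_def)
  ultimately have H2: "T * (real (card B))\<^sup>2 \<le> (\<Sum>h\<in>H. (r h)\<^sup>2)"
    unfolding E by linarith
  have "T ^ (k + 1) * (real (card B))\<^sup>2 = T ^ k * (T * (real (card B))\<^sup>2)"
    by simp
  also have "\<dots> \<le> T ^ k * (\<Sum>h\<in>H. (r h)\<^sup>2)"
    using H2 T0 by (intro mult_left_mono) auto
  also have "\<dots> \<le> (\<Sum>h\<in>H. r h ^ (k + 2))"
    unfolding sum_distrib_left power_add using T0
    by (intro sum_mono mult_right_mono power_mono) (auto simp: H_def r_def)
  finally show ?thesis by (simp add: H_def r_def)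
qed

lemma PiE_filter_eq:
  "{t. t \<in> PiE I (\<lambda>_. X) \<and> (\<forall>i\<in>I. R (t i))} = PiE I (\<lambda>_. {n\<in>X. R n})"
  by (auto simp: PiE_iff extensional_def)

lemma mult_mod_cancel_cong:
  assumes "prime p" "\<not> [d = 0] (mod int p)" "[u * d = v * d] (mod int p)"
  shows "[u = v] (mod int p)"
proof -
  have "coprime (int p) d"
    using assms(1,2) by (intro prime_imp_coprime) (auto simp: cong_0_iff)
  then show ?thesis
    using assms(3) by (subst (asm) cong_mult_rcancel) (auto simp: coprime_commute)
qed

text \<open>Dependent random choice: \<open>h\<close> is drawn with probability proportional to \<open>r h ^ k\<close>, where \<open>r h\<close>
  is the number of \<open>n \<in> B\<close> with \<open>n - h \<in> B\<close>, and \<open>k\<close> elements are drawn from these \<open>n\<close>. Given the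
  sample, \<open>h\<close> ranges over a large set \<open>W\<close> whose residues are confined to the set \<open>U\<close> left uncovered
  by the sample.\<close>

lemma dependent_random_choice:
  fixes \<epsilon> \<beta> \<tau> T :: real and N k :: nat and B :: "int set"
  defines "H \<equiv> {h. h \<in> {- int N..int N} \<and> T \<le> diff_count B h}"
  assumes B: "B \<subseteq> {1..int N}" and \<epsilon>: "0 < \<epsilon>" "\<epsilon> \<le> 1" and k: "(1 - \<epsilon>\<^sup>2 / 144) ^ k \<le> \<epsilon> / 8" "k > 0"
    and P: "finite P" "\<And>p. p \<in> P \<Longrightarrow> prime p" "\<And>p. p \<in> P \<Longrightarrow> 8 / \<epsilon> \<le> real p"
      "0 < (\<Sum>p\<in>P. ln (real p) / real p)"
    and AP: "\<And>p. p \<in> P \<Longrightarrow> \<exists>L. in_AP_mod B p L \<and> real L \<le> (1 - \<epsilon>) * real p"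
    and sieve: "\<And>S :: int set. \<lbrakk>finite S; S \<noteq> {}; \<And>x y. x \<in> S \<Longrightarrow> y \<in> S \<Longrightarrow> \<bar>x - y\<bar> \<le> 2 * int N; \<tau> \<le> card S\<rbrakk> \<Longrightarrow>
        \<beta> * (\<Sum>p\<in>P. ln (real p) / real p) \<le> (\<Sum>p\<in>P. ln (real p) / real p * eff_density S p)"
    and \<tau>: "0 < \<tau>" "\<tau> \<le> T" "0 \<le> \<beta>"
  shows "2 * \<beta> * (\<Sum>h\<in>H. real (diff_count B h) ^ k) \<le>
    (1 - \<epsilon> / 4) * (\<Sum>h\<in>H. real (diff_count B h) ^ k) + \<beta> * \<tau> * real (card B) ^ k"
proof -
  define wt where "wt p = ln (real p) / real p" for p :: nat
  define \<Lambda> where "\<Lambda> = (\<Sum>p\<in>P. wt p)"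
  have "\<exists>L a d x. \<not> [d = 0] (mod int p) \<and> real L \<le> (1 - \<epsilon>) * real p \<and>
      (\<forall>n\<in>B. x n < L \<and> [n = a + int (x n) * d] (mod int p))" if "p \<in> P" for p
    using AP[OF that] unfolding in_AP_mod_def by metis
  then obtain L a d x where
    d: "\<And>p. p \<in> P \<Longrightarrow> \<not> [d p = 0] (mod int p)" and
    L: "\<And>p. p \<in> P \<Longrightarrow> real (L p) \<le> (1 - \<epsilon>) * real p" and
    x: "\<And>p n. p \<in> P \<Longrightarrow> n \<in> B \<Longrightarrow> x p n < L p \<and> [n = a p + int (x p n) * d p] (mod int p)"
    by metis
  define A where "A h = {n\<in>B. n - h \<in> B}" for h
  define tuples where "tuples X = PiE {..<k} (\<lambda>_. X)" for X :: "int set"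
  \<comment> \<open>These are the \<open>z\<close> for which all sampled positions, shifted back by
    \<open>z\<close>, stay in the progression: the dilated residues left to \<open>h\<close> in
    \<open>W t\<close>.\<close>
  define U where "U p t = {z\<in>{..<p}. \<forall>i<k. (int (x p (t i)) - int z) mod int p < int (L p)}" for p and t :: "nat \<Rightarrow> int"
  define W where "W t = {h\<in>H. \<forall>i<k. t i - h \<in> B}" for t
  define u where "u t = (\<Sum>p\<in>P. wt p * (card (U p t) / p))" for t
  define M where "M = (\<Sum>h\<in>H. real (card (A h)) ^ k)"
  have finB: "finite B" using B by (rule finite_if_subset_initial)
  have finA: "finite (A h)" for h using finB by (simp add: A_def)
  have finH: "finite H"
    by (rule finite_subset [of _ "{- int N..int N}"]) (auto simp: H_def)
  have fint: "finite (tuples X)" if "finite X" for X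
    unfolding tuples_def using that by (intro finite_PiE) auto
  have cardt: "card (tuples X) = card X ^ k" if "finite X" for X
    unfolding tuples_def using that by (subst card_PiE) auto
  have r: "diff_count B h = card (A h)" for h by (simp add: diff_count_def A_def)
  have wt: "wt p \<ge> 0" if "p \<in> P" for p
    using P(2)[OF that, THEN prime_ge_1_nat] by (simp add: wt_def)
  have p0: "p > 0" if "p \<in> P" for p
    using P(2)[OF that] by (rule prime_gt_0_nat)
  have Lp: "L p \<le> p" if "p \<in> P" for p
  proof -
    have "(1 - \<epsilon>) * real p \<le> 1 * real p" using \<epsilon> by (intro mult_right_mono) auto
    then show ?thesis using L[OF that] by linarith
  qed
  have A: "A h \<noteq> {}" "\<tau> \<le> card (A h)" if "h \<in> H" for h
  proof -
    show "\<tau> \<le> card (A h)" using that \<tau> by (auto simp: H_def r)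
    then show "A h \<noteq> {}" using \<tau> by auto
  qed
  have xc: "[m = n] (mod int p)" if "p \<in> P" "m \<in> B" "n \<in> B" "x p m = x p n" for p m n
    using x[OF that(1,2)] x[OF that(1,3)] that(4) by (metis cong_sym cong_trans)

  \<comment> \<open>For fixed \<open>z\<close> the condition applies to each coordinate of the tuple
    separately, which produces the power \<open>k\<close>.\<close>
  have count: "(\<Sum>t\<in>tuples (A h). real (card (U p t))) =
      (\<Sum>z<p. real (card {n\<in>A h. (int (x p n) - int z) mod int p < int (L p)}) ^ k)" for h p
  proof -
    have "(\<Sum>t\<in>tuples (A h). real (card (U p t))) =
        (\<Sum>t\<in>tuples (A h). \<Sum>z | z \<in> {..<p} \<and> (\<forall>i<k. (int (x p (t i)) - int z) mod int p < int (L p)). 1)"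
      by (simp add: U_def)
    also have "\<dots> = (\<Sum>z<p. \<Sum>t | t \<in> tuples (A h) \<and> (\<forall>i<k. (int (x p (t i)) - int z) mod int p < int (L p)). 1)"
      using fint[OF finA] by (rule sum.swap_restrict) simp
    also have "\<dots> = (\<Sum>z<p. real (card {n\<in>A h. (int (x p n) - int z) mod int p < int (L p)}) ^ k)"
    proof (rule sum.cong [OF refl])
      fix z
      have "{t. t \<in> tuples (A h) \<and> (\<forall>i<k. (int (x p (t i)) - int z) mod int p < int (L p))} =
          tuples {n\<in>A h. (int (x p n) - int z) mod int p < int (L p)}"
        using PiE_filter_eq[of "{..<k}" "A h" "\<lambda>n. (int (x p n) - int z) mod int p < int (L p)"]
        by (simp only: tuples_def Ball_def lessThan_iff)
      then show "(\<Sum>t | t \<in> tuples (A h) \<and> (\<forall>i<k. (int (x p (t i)) - int z) mod int p < int (L p)). 1) =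
          real (card {n\<in>A h. (int (x p n) - int z) mod int p < int (L p)}) ^ k"
        using cardt[OF finite_subset[OF _ finA[of h]], of "{n\<in>A h. (int (x p n) - int z) mod int p < int (L p)}"]
        by (simp only: real_of_card [symmetric] of_nat_power Collect_restrict)
    qed
    finally show ?thesis .
  qed
  have upper: "(\<Sum>t\<in>tuples (A h). card (U p t) / p) + card (A h) ^ k * eff_density (A h) p \<le>
      (1 - \<epsilon> / 4) * card (A h) ^ k" if "h \<in> H" "p \<in> P" for h p
  proof -
    let ?c = "real (card (A h))"
    have c: "?c > 0" using A[OF that(1)] finA by (simp add: card_gt_0_iff)
    have "(\<Sum>z<p. (card {n\<in>A h. (int (x p n) - int z) mod int p < int (L p)} / ?c) ^ k) / p
        + eff_density (A h) p \<le> 1 - \<epsilon> / 4"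
      using that x xc by (intro expected_uncovered_density finA A \<epsilon> L P k) (auto simp: A_def)
    also have "(\<Sum>z<p. (card {n\<in>A h. (int (x p n) - int z) mod int p < int (L p)} / ?c) ^ k) =
        (\<Sum>t\<in>tuples (A h). real (card (U p t))) / ?c ^ k"
      unfolding count by (simp add: power_divide sum_divide_distrib)
    finally have "?c ^ k * ((\<Sum>t\<in>tuples (A h). real (card (U p t))) / ?c ^ k / p + eff_density (A h) p) \<le>
        ?c ^ k * (1 - \<epsilon> / 4)"
      by (intro mult_left_mono) auto
    then show ?thesis
      using c by (simp add: distrib_left sum_divide_distrib[symmetric] mult.commute)
  qed

  have W_sub: "eff_density (W t) p \<le> card (U p t) / p" if t: "t \<in> tuples B" and p: "p \<in> P" for t p
  proof -
    \<comment> \<open>Modulo \<open>p\<close>, \<open>h\<close> is \<open>d p\<close> times the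
      difference of the positions of \<open>t i\<close> and \<open>t i - h\<close>, whatever
      \<open>i\<close> is. The coordinate \<open>0\<close> exists because
      \<open>k > 0\<close>.\<close>
    define z where "z h = nat ((int (x p (t 0)) - int (x p (t 0 - h))) mod int p)" for h
    have hz: "[h = int (z h) * d p] (mod int p)"
      and zU: "z h \<in> U p t" if h: "h \<in> W t" for h
    proof -
      have h_cong: "[h = (int (x p (t i)) - int (x p (t i - h))) * d p] (mod int p)" if "i < k" for i
      proof -
        have "t i \<in> B" "t i - h \<in> B"
          using t h that by (auto simp: tuples_def W_def)
        then have "[t i - (t i - h) = a p + int (x p (t i)) * d p - (a p + int (x p (t i - h)) * d p)] (mod int p)"
          using x[OF p] by (intro cong_diff) auto
        then show ?thesis by (simp add: algebra_simps)
      qed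
      have z0: "int (z h) = (int (x p (t 0)) - int (x p (t 0 - h))) mod int p"
        using p0[OF p] by (simp add: z_def)
      then have zc: "[int (z h) = int (x p (t 0)) - int (x p (t 0 - h))] (mod int p)"
        by (simp add: Cong.cong_def)
      then have "[int (z h) * d p = (int (x p (t 0)) - int (x p (t 0 - h))) * d p] (mod int p)"
        by (rule cong_mult) simp
      with h_cong[OF k(2)] show hz: "[h = int (z h) * d p] (mod int p)"
        using cong_sym cong_trans by blast
      have "(int (x p (t i)) - int (z h)) mod int p < int (L p)" if "i < k" for i
      proof -
        have "t i - h \<in> B" using h that by (auto simp: W_def)
        then have xL: "x p (t i - h) < L p" using x[OF p] by blast
        have "[(int (x p (t i)) - int (x p (t i - h))) * d p = int (z h) * d p] (mod int p)"
          using h_cong[OF that] hz by (meson cong_sym cong_trans)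
        then have "[int (x p (t i)) - int (x p (t i - h)) = int (z h)] (mod int p)"
          by (rule mult_mod_cancel_cong[OF P(2)[OF p] d[OF p]])
        then have "[int (x p (t i)) - int (z h) = int (x p (t i - h))] (mod int p)"
          by (simp add: cong_iff_dvd_diff algebra_simps)
        then have "(int (x p (t i)) - int (z h)) mod int p = int (x p (t i - h)) mod int p"
          by (simp add: Cong.cong_def)
        also have "\<dots> = int (x p (t i - h))"
          using xL Lp[OF p] by simp
        finally show ?thesis using xL by simp
      qed
      moreover have "int (z h) < int p"
        unfolding z0 using p0[OF p] by simp
      ultimately show "z h \<in> U p t" by (simp add: U_def)
    qed
    show ?thesis
    proof (rule eff_density_le[where g = z])
      show "finite (W t)" using finH by (simp add: W_def)
      show "finite (U p t)" by (simp add: U_def)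
      show "z ` W t \<subseteq> U p t" using zU by blast
      show "p > 0" using p by (rule p0)
      show "[h = h'] (mod int p)" if "h \<in> W t" "h' \<in> W t" "z h = z h'" for h h'
        using hz[OF that(1)] hz[OF that(2)] that(3) by (metis cong_sym cong_trans)
    qed
  qed
  have u_nonneg: "u t \<ge> 0" for t
    unfolding u_def using wt by (intro sum_nonneg mult_nonneg_nonneg) auto
  \<comment> \<open>Subtracting \<open>\<tau>\<close> covers also the tuples whose
    \<open>W t\<close> is too small for the sieve, since the left side is then not positive.\<close>
  have lower: "\<beta> * \<Lambda> * (card (W t) - \<tau>) \<le> card (W t) * u t" if t: "t \<in> tuples B" for t
  proof (cases "\<tau> \<le> card (W t)")
    case True
    have "W t \<noteq> {}" using True \<tau>(1) by auto
    moreover have "finite (W t)" using finH by (simp add: W_def)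
    moreover have "\<bar>h - h'\<bar> \<le> 2 * int N" if "h \<in> W t" "h' \<in> W t" for h h'
      using that by (auto simp: W_def H_def)
    ultimately have "\<beta> * \<Lambda> \<le> (\<Sum>p\<in>P. wt p * eff_density (W t) p)"
      unfolding \<Lambda>_def wt_def using True by (intro sieve)
    also have "\<dots> \<le> u t"
      unfolding u_def using wt W_sub[OF t] by (intro sum_mono mult_left_mono) auto
    finally have "card (W t) * (\<beta> * \<Lambda>) \<le> card (W t) * u t"
      by (intro mult_left_mono) auto
    moreover have "0 \<le> \<beta> * \<Lambda> * \<tau>"
      using \<tau> P(4) by (simp add: \<Lambda>_def wt_def)
    ultimately show ?thesis by (simp add: algebra_simps)
  next
    case False
    then have "\<beta> * \<Lambda> * (card (W t) - \<tau>) \<le> 0"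
      using \<tau> P(4) by (intro mult_nonneg_nonpos) (auto simp: \<Lambda>_def wt_def)
    also have "\<dots> \<le> card (W t) * u t"
      using u_nonneg by simp
    finally show ?thesis .
  qed
  \<comment> \<open>Double counting: for \<open>h\<close> in \<open>H\<close>, a tuple
    \<open>t\<close> from \<open>B\<close> has all entries in \<open>A h\<close> exactly when
    \<open>h\<close> lies in \<open>W t\<close>.\<close>
  have swap: "(\<Sum>h\<in>H. \<Sum>t\<in>tuples (A h). f t) = (\<Sum>t\<in>tuples B. card (W t) * f t)" for f :: "(nat \<Rightarrow> int) \<Rightarrow> real"
  proof -
    have "tuples (A h) = {t. t \<in> tuples B \<and> (\<forall>i<k. t i - h \<in> B)}" for h
      using PiE_filter_eq[of "{..<k}" B "\<lambda>n. n - h \<in> B"]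
      by (simp only: tuples_def A_def Ball_def lessThan_iff)
    then have "(\<Sum>h\<in>H. \<Sum>t\<in>tuples (A h). f t) = (\<Sum>h\<in>H. \<Sum>t | t \<in> tuples B \<and> (\<forall>i<k. t i - h \<in> B). f t)"
      by simp
    also have "\<dots> = (\<Sum>t\<in>tuples B. \<Sum>h | h \<in> H \<and> (\<forall>i<k. t i - h \<in> B). f t)"
      using finH fint[OF finB] by (rule sum.swap_restrict)
    finally show ?thesis by (simp add: W_def)
  qed
  have M: "M = (\<Sum>t\<in>tuples B. real (card (W t)))"
    using swap[of "\<lambda>_. 1"] finA by (simp add: M_def cardt)
  have "\<beta> * \<Lambda> * (M - \<tau> * real (card B) ^ k) = (\<Sum>t\<in>tuples B. \<beta> * \<Lambda> * (card (W t) - \<tau>))"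
    using finB by (simp add: M sum_distrib_left[symmetric] sum_subtractf cardt)
  also have "\<dots> \<le> (\<Sum>t\<in>tuples B. card (W t) * u t)"
    using lower by (rule sum_mono)
  also have "\<dots> = (\<Sum>h\<in>H. \<Sum>t\<in>tuples (A h). u t)"
    by (rule swap [symmetric])
  also have "\<dots> = (\<Sum>h\<in>H. \<Sum>p\<in>P. wt p * (\<Sum>t\<in>tuples (A h). card (U p t) / p))"
    unfolding u_def sum_distrib_left by (rule sum.cong [OF refl], rule sum.swap)
  finally have part1: "\<beta> * \<Lambda> * (M - \<tau> * real (card B) ^ k) \<le>
      (\<Sum>h\<in>H. \<Sum>p\<in>P. wt p * (\<Sum>t\<in>tuples (A h). card (U p t) / p))" .
  have "\<beta> * \<Lambda> * M = (\<Sum>h\<in>H. real (card (A h)) ^ k * (\<beta> * \<Lambda>))"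
    by (simp add: M_def sum_distrib_left mult_ac)
  also have "\<dots> \<le> (\<Sum>h\<in>H. real (card (A h)) ^ k * (\<Sum>p\<in>P. wt p * eff_density (A h) p))"
  proof (intro sum_mono mult_left_mono)
    fix h assume "h \<in> H"
    have "\<bar>m - n\<bar> \<le> 2 * int N" if "m \<in> A h" "n \<in> A h" for m n
    proof -
      have "1 \<le> m \<and> m \<le> int N" "1 \<le> n \<and> n \<le> int N" using that B by (auto simp: A_def)
      then show ?thesis by linarith
    qed
    then show "\<beta> * \<Lambda> \<le> (\<Sum>p\<in>P. wt p * eff_density (A h) p)"
      unfolding \<Lambda>_def wt_def using A[OF \<open>h \<in> H\<close>] finA by (intro sieve) auto
  qed auto
  also have "\<dots> = (\<Sum>h\<in>H. \<Sum>p\<in>P. wt p * (card (A h) ^ k * eff_density (A h) p))"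
    by (simp add: sum_distrib_left mult_ac)
  \<comment> \<open>The sieve enters twice, for the sets \<open>W t\<close> in the first term and
    for the sets \<open>A h\<close> in the second; \<open>upper\<close> bounds both
    together.\<close>
  finally have "\<beta> * \<Lambda> * (M - \<tau> * real (card B) ^ k) + \<beta> * \<Lambda> * M \<le>
      (\<Sum>h\<in>H. \<Sum>p\<in>P. wt p * ((\<Sum>t\<in>tuples (A h). card (U p t) / p) + card (A h) ^ k * eff_density (A h) p))"
    using part1 by (simp add: distrib_left sum.distrib)
  also have "\<dots> \<le> (\<Sum>h\<in>H. \<Sum>p\<in>P. wt p * ((1 - \<epsilon> / 4) * card (A h) ^ k))"
    using wt upper by (intro sum_mono mult_left_mono) auto
  also have "\<dots> = (\<Sum>h\<in>H. \<Lambda> * ((1 - \<epsilon> / 4) * real (card (A h)) ^ k))"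
    by (simp add: \<Lambda>_def sum_distrib_right)
  also have "\<dots> = \<Lambda> * ((1 - \<epsilon> / 4) * M)"
    by (simp only: M_def sum_distrib_left)
  finally have "\<Lambda> * (2 * \<beta> * M) \<le> \<Lambda> * ((1 - \<epsilon> / 4) * M + \<beta> * \<tau> * real (card B) ^ k)"
    by (simp add: algebra_simps)
  moreover have "\<Lambda> > 0" using P(4) by (simp add: \<Lambda>_def wt_def)
  ultimately show ?thesis
    by (simp add: M_def r)
qed

section \<open>Asymptotic choice of exponents and conclusion\<close>

section \<open>Choice of parameters\<close>

lemma in_AP_mod_subset: "in_AP_mod B p L \<Longrightarrow> B' \<subseteq> B \<Longrightarrow> in_AP_mod B' p L"
  unfolding in_AP_mod_def by blast

lemma harm_le_ln_plus_one:
  assumes "n > 0"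
  shows "harm n \<le> ln (real n) + (1 :: real)"
  using assms
proof (induction n rule: nat_induct_non_zero)
  case 1
  show ?case by (simp add: harm_def)
next
  case (Suc n)
  have "ln (real n / real (Suc n)) \<le> real n / real (Suc n) - 1"
    using Suc by (intro ln_le_minus_one) auto
  also have "\<dots> = - inverse (real (Suc n))" by (simp add: field_simps)
  finally have "inverse (real (Suc n)) \<le> ln (real (Suc n)) - ln (real n)"
    using Suc by (simp add: ln_div)
  with Suc show ?case by (simp add: harm_Suc)
qed

text \<open>Up to logarithms the left side has exponent \<open>1 / 2 - 2 * c\<close>, while the
  prime count contributes at least \<open>1 / 2 - c / 2\<close>.\<close>

lemma eventually_popular_threshold:
  fixes c e :: real
  assumes "0 < c" "c < 1 / 4" "0 < e"
  shows "eventually (\<lambda>n. 2 * (2 * real n + 1 + real n * harm n) * harm (nat \<lfloor>sqrt (real n)\<rfloor>) ^ 3 *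
      real n powr (- 1 / 2 - 2 * c) \<le> e * real (card {p. prime p \<and> p \<le> nat \<lfloor>sqrt (real n)\<rfloor>})) at_top"
proof -
  have lim: "filterlim (\<lambda>n. nat \<lfloor>sqrt (real n)\<rfloor>) at_top at_top"
    by real_asymp
  have "eventually (\<lambda>n. real (nat \<lfloor>sqrt (real n)\<rfloor>) powr (1 - c) \<le> real (card {p. prime p \<and> p \<le> nat \<lfloor>sqrt (real n)\<rfloor>})) at_top"
    using eventually_compose_filterlim[OF eventually_prime_count_ge[OF assms(1)] lim] .
  moreover have "eventually (\<lambda>n::nat. 2 * (2 * real n + 1 + real n * (ln (real n) + 1)) * (ln (real n) + 1) ^ 3 *
      real n powr (- 1 / 2 - 2 * c) \<le> e * (sqrt (real n) - 1) powr (1 - c)) at_top"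
    using assms by real_asymp
  ultimately show ?thesis
    using eventually_ge_at_top[of 1]
  proof eventually_elim
    case (elim n)
    define Q where "Q = nat \<lfloor>sqrt (real n)\<rfloor>"
    have Q: "sqrt (real n) - 1 \<le> real Q" "real Q \<le> sqrt (real n)" "1 \<le> sqrt (real n)"
      using elim(3) by (simp_all add: Q_def)
    have "Q \<ge> 1" using elim(3) by (simp add: Q_def le_nat_iff le_floor_iff)
    have "sqrt (real n) \<le> real n"
      using Q(3) mult_right_mono[OF Q(3), of "sqrt (real n)"] by simp
    then have "Q \<le> n" using Q(2) by linarith
    have ln_nonneg: "0 \<le> ln (real n)" using elim(3) by simp
    have hQ: "harm Q \<le> ln (real n) + (1::real)"
      using harm_mono[OF \<open>Q \<le> n\<close>, where ?'a = real] harm_le_ln_plus_one[of n] elim(3) by simp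
    have hn: "harm n \<le> ln (real n) + (1::real)"
      using harm_le_ln_plus_one[of n] elim(3) by simp
    have "2 * (2 * real n + 1 + real n * harm n) * harm Q ^ 3 * real n powr (- 1 / 2 - 2 * c) \<le>
        2 * (2 * real n + 1 + real n * (ln (real n) + 1)) * (ln (real n) + 1) ^ 3 * real n powr (- 1 / 2 - 2 * c)"
      using hQ hn ln_nonneg by (intro mult_mono power_mono add_mono order.refl) (auto simp: harm_nonneg intro!: add_nonneg_nonneg mult_nonneg_nonneg)
    also have "\<dots> \<le> e * (sqrt (real n) - 1) powr (1 - c)"
      by (rule elim(2))
    also have "\<dots> \<le> e * real Q powr (1 - c)"
      using Q assms by (intro mult_left_mono powr_mono2) auto
    also have "\<dots> \<le> e * real (card {p. prime p \<and> p \<le> Q})"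
      using elim(1) assms by (intro mult_left_mono) (auto simp: Q_def)
    finally show ?case by (simp add: Q_def)
  qed
qed

text \<open>Cutting the primes at \<open>n powr (1 / 2 - 2 * \<gamma>)\<close> keeps their
  logarithmic weight below the set size \<open>n powr (1 / 2 - \<gamma>)\<close> required by the
  larger sieve, and still leaves almost half of \<open>ln n\<close> in the Mertens sum.\<close>

lemma eventually_sieve_parameters:
  fixes \<gamma> :: real and p0 :: nat
  assumes "0 < \<gamma>" "\<gamma> < 1 / 8"
  shows "eventually (\<lambda>n. (1 / 2 - 4 * \<gamma>) * (ln (2 * real n) + 1) \<le>
        (\<Sum>p | prime p \<and> p0 \<le> p \<and> p \<le> nat \<lfloor>real n powr (1 / 2 - 2 * \<gamma>)\<rfloor>. ln (real p) / real p) \<and>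
      (\<Sum>p | prime p \<and> p0 \<le> p \<and> p \<le> nat \<lfloor>real n powr (1 / 2 - 2 * \<gamma>)\<rfloor>. ln (real p)) \<le> real n powr (1 / 2 - \<gamma>)) at_top"
proof -
  have lim: "filterlim (\<lambda>n. nat \<lfloor>real n powr (1 / 2 - 2 * \<gamma>)\<rfloor>) at_top at_top"
    using assms by real_asymp
  have "eventually (\<lambda>n. (1 - \<gamma>) * ln (real (nat \<lfloor>real n powr (1 / 2 - 2 * \<gamma>)\<rfloor>)) \<le>
      (\<Sum>p | prime p \<and> p0 \<le> p \<and> p \<le> nat \<lfloor>real n powr (1 / 2 - 2 * \<gamma>)\<rfloor>. ln (real p) / real p)) at_top"
    using eventually_compose_filterlim[OF eventually_sum_ln_prime_over_prime_ge[OF assms(1)] lim] .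
  moreover have "eventually (\<lambda>n::nat. 2 \<le> \<gamma> * ln (real n)) at_top"
    using assms by real_asymp
  moreover have "eventually (\<lambda>n::nat. real n powr (1 / 2 - 2 * \<gamma>) * ln (real n) \<le> real n powr (1 / 2 - \<gamma>)) at_top"
    using assms by real_asymp
  moreover have "eventually (\<lambda>n::nat. real n powr (1 / 2 - 2 * \<gamma>) > 2) at_top"
    using assms by real_asymp
  ultimately show ?thesis
    using eventually_ge_at_top[of 1]
  proof eventually_elim
    case (elim n)
    define z where "z = real n powr (1 / 2 - 2 * \<gamma>)"
    define y where "y = nat \<lfloor>z\<rfloor>"
    have y: "z - 1 \<le> real y" "real y \<le> z" "z > 2"
      using elim(4) by (simp_all add: y_def z_def)
    have "z \<le> real n powr 1"
      unfolding z_def using elim(5) assms by (intro powr_mono) auto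
    then have "z \<le> real n" using elim(5) by simp
    have "(1 / 2 - 4 * \<gamma>) * (ln (2 * real n) + 1) \<le> (1 - \<gamma>) * ((1 / 2 - 2 * \<gamma>) * ln (real n) - ln 2)"
    proof -
      have "0 \<le> \<gamma> * (\<gamma> * ln (real n))" "0 \<le> \<gamma> * ln 2" "ln 2 \<le> (1::real)"
        using assms elim(5) ln_le_minus_one[of "2::real"] by simp_all
      then have "0 \<le> 3 / 2 * (\<gamma> * ln (real n)) + 2 * (\<gamma> * (\<gamma> * ln (real n))) + 5 * (\<gamma> * ln 2) + 4 * \<gamma> - 3 / 2 * ln 2 - 1 / 2"
        using elim(2) assms by linarith
      also have "\<dots> = (1 - \<gamma>) * ((1 / 2 - 2 * \<gamma>) * ln (real n) - ln 2) - (1 / 2 - 4 * \<gamma>) * (ln 2 + ln (real n) + 1)"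
        by (simp add: field_simps)
      also have "ln 2 + ln (real n) = ln (2 * real n)"
        using elim(5) by (simp add: ln_mult)
      finally show ?thesis
        by (simp only: diff_ge_0_iff_ge)
    qed
    also have "(1 / 2 - 2 * \<gamma>) * ln (real n) - ln 2 = ln (z / 2)"
      using elim(5) by (simp add: z_def ln_div ln_powr)
    also have "(1 - \<gamma>) * ln (z / 2) \<le> (1 - \<gamma>) * ln (z - 1)"
      using y assms by (intro mult_left_mono ln_mono) auto
    also have "\<dots> \<le> (1 - \<gamma>) * ln (real y)"
      using y assms by (intro mult_left_mono ln_mono) auto
    also have "\<dots> \<le> (\<Sum>p | prime p \<and> p0 \<le> p \<and> p \<le> y. ln (real p) / real p)"
      using elim(1) by (simp add: y_def z_def)
    finally have 1: "(1 / 2 - 4 * \<gamma>) * (ln (2 * real n) + 1) \<le>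
      (\<Sum>p | prime p \<and> p0 \<le> p \<and> p \<le> y. ln (real p) / real p)" .
    have "(\<Sum>p | prime p \<and> p0 \<le> p \<and> p \<le> y. ln (real p)) \<le> (\<Sum>p\<in>{1..y}. ln (real n))"
    proof (rule order.trans[OF sum_mono sum_mono2])
      fix p assume "p \<in> {p. prime p \<and> p0 \<le> p \<and> p \<le> y}"
      then have "real p \<le> real n" "0 < real p"
        using y \<open>z \<le> real n\<close> prime_gt_0_nat by auto
      then show "ln (real p) \<le> ln (real n)" by (rule ln_mono)
    qed (use elim(5) prime_ge_1_nat in auto)
    also have "\<dots> = real y * ln (real n)" by simp
    also have "\<dots> \<le> z * ln (real n)"
      using y elim(5) by (intro mult_right_mono) auto
    also have "\<dots> \<le> real n powr (1 / 2 - \<gamma>)"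
      using elim(3) by (simp add: z_def)
    finally show ?case using 1 by (simp add: y_def z_def)
  qed
qed

lemma exists_power_le:
  fixes q \<delta> :: real
  assumes "0 \<le> q" "q < 1" "0 < \<delta>"
  obtains k :: nat where "q ^ k \<le> \<delta>"
proof -
  have "(\<lambda>k. q ^ k) \<longlonglongrightarrow> 0" using assms by (intro LIMSEQ_realpow_zero) auto
  then have "eventually (\<lambda>k. q ^ k < \<delta>) at_top" using assms by (intro order_tendstoD) auto
  then show thesis using that by (auto simp: eventually_at_top_linorder intro: less_imp_le)
qed

text \<open>Here \<open>c\<close> and \<open>n0\<close> are fixed before \<open>n\<close> and
  \<open>B\<close>, which gives the uniformity over all sets needed for the final constant.\<close>

lemma card_bound_of_AP_residues:
  fixes \<epsilon> :: real
  assumes \<epsilon>: "0 < \<epsilon>" "\<epsilon> \<le> 1"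
  obtains c :: real and n0 :: nat where "0 < c" "c < 1 / 2"
    "\<And>n B. \<lbrakk>n \<ge> n0; B \<subseteq> {1..int n};
        \<And>p. prime p \<Longrightarrow> p\<^sup>2 \<le> n \<Longrightarrow> \<exists>L. in_AP_mod B p L \<and> real L \<le> (1 - \<epsilon>) * real p\<rbrakk> \<Longrightarrow>
      real (card B) \<le> real n powr (1 / 2 - c)"
proof -
  have "0 \<le> 1 - \<epsilon>\<^sup>2 / 144" using power_le_one[of \<epsilon> 2] \<epsilon> by simp
  then obtain K where K: "(1 - \<epsilon>\<^sup>2 / 144) ^ K \<le> \<epsilon> / 8"
    using exists_power_le[of "1 - \<epsilon>\<^sup>2 / 144" "\<epsilon> / 8"] \<epsilon> by auto
  (* With tau = n^(1/2 - gamma), m about n^(1/2 - c) and T at least n^(1/2 - 4c), this c makes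
     tau * m^K smaller than T^(K + 1) by a factor n^(2c). *)
  define \<gamma> where "\<gamma> = \<epsilon> / 64"
  define c where "c = \<gamma> / (3 * (real K + 2))"
  define p0 where "p0 = nat \<lceil>8 / \<epsilon>\<rceil>"
  have \<gamma>: "0 < \<gamma>" "\<gamma> < 1 / 8" using \<epsilon> by (auto simp: \<gamma>_def)
  have c: "0 < c" "c * (3 * (real K + 2)) = \<gamma>" using \<gamma> by (auto simp: c_def)
  have "c * 6 \<le> c * (3 * (real K + 2))" using c(1) by (intro mult_left_mono) auto
  then have c\<gamma>: "6 * c \<le> \<gamma>" using c(2) by simp
  then have c4: "c < 1 / 4" using \<gamma> by linarith
  define good where "good n \<longleftrightarrow>
      2 * (2 * real n + 1 + real n * harm n) * harm (nat \<lfloor>sqrt (real n)\<rfloor>) ^ 3 * real n powr (- 1 / 2 - 2 * c) \<le>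
        \<epsilon> ^ 4 * real (card {p. prime p \<and> p \<le> nat \<lfloor>sqrt (real n)\<rfloor>}) \<and>
      (1 / 2 - 4 * \<gamma>) * (ln (2 * real n) + 1) \<le>
        (\<Sum>p | prime p \<and> p0 \<le> p \<and> p \<le> nat \<lfloor>real n powr (1 / 2 - 2 * \<gamma>)\<rfloor>. ln (real p) / real p) \<and>
      (\<Sum>p | prime p \<and> p0 \<le> p \<and> p \<le> nat \<lfloor>real n powr (1 / 2 - 2 * \<gamma>)\<rfloor>. ln (real p)) \<le> real n powr (1 / 2 - \<gamma>) \<and>
      2 ^ K * real n powr (- 2 * c) \<le> \<epsilon> / 16 \<and> n \<ge> 1" for n :: nat
  have ev1: "eventually (\<lambda>n::nat. 2 ^ K * real n powr (- 2 * c) \<le> \<epsilon> / 16) at_top"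
    using c(1) \<epsilon> by real_asymp
  have "eventually good at_top"
    using eventually_popular_threshold[OF c(1) c4, of "\<epsilon> ^ 4"] eventually_sieve_parameters[OF \<gamma>, of p0]
      ev1 eventually_ge_at_top[of 1] \<epsilon>
    unfolding good_def by (simp add: eventually_conj_iff)
  then obtain n0 where n0: "\<And>n. n \<ge> n0 \<Longrightarrow> good n"
    by (auto simp: eventually_at_top_linorder)
  have "real (card B0) \<le> real n powr (1 / 2 - c)"
    if n: "n \<ge> n0" and B0: "B0 \<subseteq> {1..int n}"
      and AP0: "\<And>p. prime p \<Longrightarrow> p\<^sup>2 \<le> n \<Longrightarrow> \<exists>L. in_AP_mod B0 p L \<and> real L \<le> (1 - \<epsilon>) * real p" for n B0
  proof (rule ccontr)
    assume contra: "\<not> real (card B0) \<le> real n powr (1 / 2 - c)"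
    \<comment> \<open>The set is trimmed to exactly \<open>m\<close> elements, so that its size is
      bounded above as well as below.\<close>
    define m where "m = nat \<lceil>real n powr (1 / 2 - c)\<rceil>"
    have "m \<le> card B0" using contra unfolding m_def by linarith
    then obtain B where B: "B \<subseteq> B0" "card B = m"
      by (meson obtain_subset_with_card_n)
    have Bn: "B \<subseteq> {1..int n}" using B B0 by blast
    have AP: "\<exists>L. in_AP_mod B p L \<and> real L \<le> (1 - \<epsilon>) * real p" if "prime p" "p\<^sup>2 \<le> n" for p
      using AP0[OF that] B(1) in_AP_mod_subset by blast
    define Q where "Q = nat \<lfloor>sqrt (real n)\<rfloor>"
    define y where "y = nat \<lfloor>real n powr (1 / 2 - 2 * \<gamma>)\<rfloor>"
    define P where "P = {p. prime p \<and> p0 \<le> p \<and> p \<le> y}"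
    define \<beta> where "\<beta> = 1 / 2 - 4 * \<gamma>"
    define T where "T = energy B n / (2 * (real m)\<^sup>2)"
    define \<tau> where "\<tau> = real n powr (1 / 2 - \<gamma>)"
    define M where "M = (\<Sum>h | h \<in> {- int n..int n} \<and> T \<le> diff_count B h. real (diff_count B h) ^ (K + 2))"
    have n1: "real n \<ge> 1" and
      g1: "2 * (2 * real n + 1 + real n * harm n) * harm Q ^ 3 * real n powr (- 1 / 2 - 2 * c) \<le>
        \<epsilon> ^ 4 * real (card {p. prime p \<and> p \<le> Q})" and
      g2: "\<beta> * (ln (2 * real n) + 1) \<le> (\<Sum>p\<in>P. ln (real p) / real p)" and
      g3: "(\<Sum>p\<in>P. ln (real p)) \<le> \<tau>" and
      g4: "2 ^ K * real n powr (- 2 * c) \<le> \<epsilon> / 16"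
      using n0[OF n] by (simp_all add: good_def Q_def P_def y_def \<beta>_def \<tau>_def)
    have npos: "real n > 0" using n1 by linarith
    have m_ge: "real n powr (1 / 2 - c) \<le> real m" unfolding m_def by linarith
    have one_le: "1 \<le> real n powr (1 / 2 - c)"
      using n1 c4 by (intro ge_one_powr_ge_zero) auto
    have m_le: "real m \<le> 2 * real n powr (1 / 2 - c)"
      using one_le unfolding m_def by linarith
    have m0: "real m > 0" using m_ge one_le by linarith
    have "B \<noteq> {}" using B(2) m0 by auto

    have T_ge: "real n powr (1 / 2 - 4 * c) \<le> T"
    proof -
      define F where "F = (2 * real n + 1 + real n * harm n) * harm Q ^ 3"
      have "Q \<ge> 1" using n1 by (simp add: Q_def le_nat_iff le_floor_iff)
      have "real Q \<le> sqrt (real n)" by (simp add: Q_def)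
      then have "(real Q)\<^sup>2 \<le> real n" using power_mono[of "real Q" "sqrt (real n)" 2] by simp
      then have Qn: "Q\<^sup>2 \<le> n" by (simp flip: of_nat_power)
      have "F > 0"
        unfolding F_def using \<open>Q \<ge> 1\<close> npos harm_pos[of Q, where ?'a = real] harm_nonneg[of n, where ?'a = real]
        by (intro mult_pos_pos add_pos_nonneg) auto
      have "real (card {p. prime p \<and> p \<le> Q}) * (\<epsilon> * card B) ^ 4 \<le> real (energy B n) * F"
        unfolding F_def mult.assoc[symmetric]
      proof (rule energy_lower_bound [OF Bn \<epsilon>(1) _ Qn])
        show "Q > 0" using \<open>Q \<ge> 1\<close> by simp
        fix p assume p: "prime p" "p \<le> Q"
        have "p\<^sup>2 \<le> Q\<^sup>2" using p(2) by (intro power_mono) auto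
        then have "p\<^sup>2 \<le> n" using Qn by (rule order.trans)
        with p show "\<exists>L. in_AP_mod B p L \<and> real L \<le> (1 - \<epsilon>) * real p" by (intro AP)
      qed
      then have up: "\<epsilon> ^ 4 * real (card {p. prime p \<and> p \<le> Q}) * real m ^ 4 \<le> real (energy B n) * F"
        by (simp add: B(2) power_mult_distrib mult_ac)
      have "2 * F * real n powr (- 1 / 2 - 2 * c) * real m ^ 4 \<le> real (energy B n) * F"
      proof -
        have "2 * F * real n powr (- 1 / 2 - 2 * c) \<le> \<epsilon> ^ 4 * real (card {p. prime p \<and> p \<le> Q})"
          using g1 by (simp only: F_def mult.assoc)
        then show ?thesis
          using mult_right_mono[of _ _ "real m ^ 4"] up by fastforce
      qed
      then have "F * (2 * real n powr (- 1 / 2 - 2 * c) * real m ^ 4) \<le> F * real (energy B n)"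
        by (simp add: mult_ac)
      then have "2 * real n powr (- 1 / 2 - 2 * c) * real m ^ 4 \<le> real (energy B n)"
        using \<open>F > 0\<close> by (simp only: mult_le_cancel_left_pos)
      then have "real n powr (- 1 / 2 - 2 * c) * (real m)\<^sup>2 \<le> T"
        using m0 by (simp add: T_def field_simps power2_eq_square power4_eq_xxxx)
      moreover have "real n powr (- 1 / 2 - 2 * c) * (real n powr (1 / 2 - c))\<^sup>2 \<le> real n powr (- 1 / 2 - 2 * c) * (real m)\<^sup>2"
        using m_ge by (intro mult_left_mono power_mono) auto
      moreover have "real n powr (- 1 / 2 - 2 * c) * (real n powr (1 / 2 - c))\<^sup>2 = real n powr (1 / 2 - 4 * c)"
        using npos by (simp add: power2_eq_square flip: powr_add)
      ultimately show ?thesis by linarith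
    qed
    have "\<tau> \<le> real n powr (1 / 2 - 4 * c)"
      unfolding \<tau>_def using n1 c\<gamma> c(1) by (intro powr_mono) auto
    then have \<tau>T: "\<tau> \<le> T" using T_ge by linarith
    have \<tau>0: "\<tau> > 0" using npos by (simp add: \<tau>_def)
    \<comment> \<open>The choice \<open>\<gamma> = \<epsilon> / 64\<close> makes
      \<open>2 * \<beta>\<close> equal to \<open>1 - \<epsilon> / 8\<close>, which exceeds the
      \<open>1 - \<epsilon> / 4\<close> of the covering estimate.\<close>
    have \<beta>: "\<beta> > 0" "\<beta> < 1 / 2" "2 * \<beta> = 1 - \<epsilon> / 8" using \<epsilon> by (auto simp: \<beta>_def \<gamma>_def)

    have M_ge: "T ^ (K + 1) * (real m)\<^sup>2 \<le> M"
      unfolding M_def B(2)[symmetric] using Bn \<open>B \<noteq> {}\<close> by (intro popular_moment_ge) (auto simp: T_def B(2))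
    have "T > 0" using \<tau>T \<tau>0 by linarith
    then have "M > 0" using M_ge m0 by (smt (verit) mult_pos_pos zero_less_power)

    have "\<tau> * real m ^ K \<le> \<tau> * (2 * real n powr (1 / 2 - c)) ^ K"
      using m_le \<tau>0 by (intro mult_left_mono power_mono) auto
    also have "\<dots> = 2 ^ K * real n powr (- 2 * c) * real n powr ((1 / 2 - 4 * c) * real (K + 1))"
    proof -
      have "1 / 2 - \<gamma> + (1 / 2 - c) * real K = - 2 * c + (1 / 2 - 4 * c) * real (K + 1)"
        using c(2) by (simp add: algebra_simps)
      then show ?thesis
        using npos by (simp add: \<tau>_def power_mult_distrib powr_realpow [symmetric] powr_powr mult_ac flip: powr_add)
    qed
    also have "\<dots> \<le> \<epsilon> / 16 * real n powr ((1 / 2 - 4 * c) * real (K + 1))"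
      using g4 by (intro mult_right_mono) auto
    also have "real n powr ((1 / 2 - 4 * c) * real (K + 1)) = (real n powr (1 / 2 - 4 * c)) ^ (K + 1)"
      using npos by (subst powr_realpow [symmetric]) (auto simp: powr_powr)
    also have "\<epsilon> / 16 * \<dots> \<le> \<epsilon> / 16 * T ^ (K + 1)"
      using T_ge \<epsilon> by (intro mult_left_mono power_mono) auto
    finally have "\<tau> * real m ^ K * (real m)\<^sup>2 \<le> \<epsilon> / 16 * T ^ (K + 1) * (real m)\<^sup>2"
      by (intro mult_right_mono) auto
    also have "\<dots> \<le> \<epsilon> / 16 * M"
      using M_ge \<epsilon> by (simp only: mult.assoc) (intro mult_left_mono, auto)
    finally have small: "\<tau> * real m ^ (K + 2) \<le> \<epsilon> / 16 * M"
      by (simp add: power_add power2_eq_square mult_ac)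

    \<comment> \<open>The moment has order \<open>K + 2\<close>, so that the error
      \<open>\<tau> * m ^ (K + 2)\<close> is compared with the lower bound
      \<open>T ^ (K + 1)\<close> times the square of \<open>m\<close>.\<close>
    have main: "2 * \<beta> * M \<le> (1 - \<epsilon> / 4) * M + \<beta> * \<tau> * real (card B) ^ (K + 2)"
      unfolding M_def
    proof (rule dependent_random_choice [where P = P and \<tau> = \<tau>])
      have "(1 - \<epsilon>\<^sup>2 / 144) ^ (K + 2) \<le> (1 - \<epsilon>\<^sup>2 / 144) ^ K"
        using \<open>0 \<le> 1 - \<epsilon>\<^sup>2 / 144\<close> by (intro power_decreasing) auto
      with K show "(1 - \<epsilon>\<^sup>2 / 144) ^ (K + 2) \<le> \<epsilon> / 8" by linarith
      show "finite P" by (simp add: P_def)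
      show "8 / \<epsilon> \<le> real p" if "p \<in> P" for p
        using that unfolding P_def p0_def by simp
      have "0 < \<beta> * (ln (2 * real n) + 1)"
        using \<beta> n1 by (intro mult_pos_pos add_nonneg_pos) auto
      then show "0 < (\<Sum>p\<in>P. ln (real p) / real p)" using g2 by linarith
      show "\<exists>L. in_AP_mod B p L \<and> real L \<le> (1 - \<epsilon>) * real p" if "p \<in> P" for p
      proof (rule AP)
        have "real p \<le> real n powr (1 / 2 - 2 * \<gamma>)"
          using that by (simp add: P_def y_def le_nat_iff le_floor_iff)
        also have "\<dots> \<le> real n powr (1 / 2)" using n1 \<gamma> by (intro powr_mono) auto
        finally have "(real p)\<^sup>2 \<le> (real n powr (1 / 2))\<^sup>2" by (intro power_mono) auto
        also have "\<dots> = real n" using npos by (simp add: powr_half_sqrt)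
        finally show "p\<^sup>2 \<le> n" by (simp flip: of_nat_power)
      qed (use that in \<open>simp add: P_def\<close>)
      fix S :: "int set"
      assume S: "finite S" "S \<noteq> {}" "\<And>x y. x \<in> S \<Longrightarrow> y \<in> S \<Longrightarrow> \<bar>x - y\<bar> \<le> 2 * int n" "\<tau> \<le> card S"
      show "\<beta> * (\<Sum>p\<in>P. ln (real p) / real p) \<le> (\<Sum>p\<in>P. ln (real p) / real p * eff_density S p)"
      proof (rule sum_eff_density_ge [where D = "2 * real n"])
        show "\<bar>real_of_int x - real_of_int y\<bar> \<le> 2 * real n" if "x \<in> S" "y \<in> S" for x y
          using S(3)[OF that] by linarith
      qed (use S g2 g3 n1 in \<open>auto simp: P_def\<close>)
    qed (use Bn \<epsilon> \<tau>0 \<tau>T \<beta> in \<open>auto simp: P_def\<close>)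
    have "\<beta> * (\<tau> * real m ^ (K + 2)) \<le> 1 / 2 * (\<epsilon> / 16 * M)"
      by (rule mult_mono [OF _ small]) (use \<beta> \<tau>0 in auto)
    \<comment> \<open>The error \<open>\<epsilon> / 32\<close> is smaller than the gain
      \<open>\<epsilon> / 4 - \<epsilon> / 8\<close>, which contradicts
      \<open>M > 0\<close>.\<close>
    with main have "(1 - \<epsilon> / 8) * M \<le> (1 - \<epsilon> / 4) * M + \<epsilon> / 32 * M"
      using \<beta>(3) by (simp add: B(2) mult_ac)
    then have "3 / 32 * (\<epsilon> * M) \<le> 0" by (simp add: algebra_simps)
    then show False using \<open>M > 0\<close> \<epsilon> by (simp add: mult_le_0_iff)
  qed
  then show thesis
    using c(1) c4 by (intro that[of c n0]) auto
qed

theorem theorem1p3: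
  fixes \<epsilon> :: real
  assumes "\<epsilon> > 0"
  shows "\<exists>\<epsilon>'>0. \<exists>C::real. \<forall>(A :: nat set) (X :: real).
           X \<ge> 1 \<longrightarrow> (\<forall>n\<in>A. n > 0) \<longrightarrow>
           (\<forall>p::nat. prime p \<and> real p \<le> X powr (1/2) \<longrightarrow>
              (\<exists>L S. is_AP_mod p L S \<and> real L \<le> (1 - \<epsilon>) * real p \<and> residues_mod A p \<subseteq> S)) \<longrightarrow>
           real (card (initial_part A X)) \<le> C * X powr (1/2 - \<epsilon>')"
proof -
  \<comment> \<open>The density argument requires a parameter of at most 1; shrinking
    \<open>\<epsilon>\<close> only weakens the confinement.\<close>
  define e where "e = min \<epsilon> 1"
  have e: "0 < e" "e \<le> 1" "e \<le> \<epsilon>" using assms by (auto simp: e_def)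
  obtain c :: real and n0 :: nat where c: "0 < c" "c < 1 / 2"
    and bound: "\<And>n B. \<lbrakk>n \<ge> n0; B \<subseteq> {1..int n};
        \<And>p. prime p \<Longrightarrow> p\<^sup>2 \<le> n \<Longrightarrow> \<exists>L. in_AP_mod B p L \<and> real L \<le> (1 - e) * real p\<rbrakk> \<Longrightarrow>
      real (card B) \<le> real n powr (1 / 2 - c)"
    using card_bound_of_AP_residues[OF e(1,2)] by metis
  have "real (card (initial_part A X)) \<le> (real n0 + 1) * X powr (1 / 2 - c)"
    if X: "X \<ge> 1"
      and AP: "\<And>p. prime p \<Longrightarrow> real p \<le> X powr (1/2) \<Longrightarrow>
        \<exists>L S. is_AP_mod p L S \<and> real L \<le> (1 - \<epsilon>) * real p \<and> residues_mod A p \<subseteq> S" for A X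
  proof -
    define n where "n = nat \<lfloor>X\<rfloor>"
    define B where "B = int ` initial_part A X"
    have n: "real n \<le> X" "initial_part A X \<subseteq> {1..n}"
      using X by (auto simp: n_def initial_part_def)
    have cardB: "card B = card (initial_part A X)"
      unfolding B_def by (intro card_image) simp
    have "B \<subseteq> int ` {1..n}" unfolding B_def using n(2) by (rule image_mono)
    then have Bn: "B \<subseteq> {1..int n}" by auto
    have X1: "1 \<le> X powr (1 / 2 - c)" using X c by (intro ge_one_powr_ge_zero) auto
    show ?thesis
    \<comment> \<open>Below \<open>n0\<close> the trivial bound is absorbed by the constant, since
      \<open>X powr (1 / 2 - c)\<close> is at least 1.\<close>
    proof (cases "n \<ge> n0")
      case True
      have "\<exists>L. in_AP_mod B p L \<and> real L \<le> (1 - e) * real p" if p: "prime p" "p\<^sup>2 \<le> n" for p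
      proof -
        have "(real p)\<^sup>2 \<le> X" using p(2) n(1) by (simp flip: of_nat_power)
        then have "real p \<le> sqrt X" by (rule real_le_rsqrt)
        then have "real p \<le> X powr (1/2)" using X by (simp add: powr_half_sqrt)
        then obtain L S where LS: "is_AP_mod p L S" "real L \<le> (1 - \<epsilon>) * real p" "residues_mod A p \<subseteq> S"
          using AP[OF p(1)] by blast
        then obtain a d where d: "\<not> [d = 0] (mod int p)" and S: "S = (\<lambda>j. (a + int j * d) mod int p) ` {..<L}"
          by (auto simp: is_AP_mod_def)
        have "\<exists>x<L. [m = a + int x * d] (mod int p)" if "m \<in> B" for m
        proof -
          have "m mod int p \<in> S"
            using that LS(3) by (auto simp: B_def initial_part_def residues_mod_def)
          then show ?thesis by (auto simp: S Cong.cong_def)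
        qed
        moreover have "(1 - \<epsilon>) * real p \<le> (1 - e) * real p"
          using e by (intro mult_right_mono) auto
        ultimately show ?thesis
          using d LS(2) unfolding in_AP_mod_def by (intro exI[of _ L]) force
      qed
      then have "real (card B) \<le> real n powr (1 / 2 - c)"
        using True Bn by (intro bound) auto
      also have "\<dots> \<le> X powr (1 / 2 - c)"
        using n(1) c by (intro powr_mono2) auto
      also have "\<dots> \<le> (real n0 + 1) * X powr (1 / 2 - c)"
        using X1 by (simp add: mult_le_cancel_right1)
      finally show ?thesis by (simp add: cardB)
    next
      case False
      have "card B \<le> card {1..int n}" using Bn by (intro card_mono) auto
      then have "real (card B) \<le> real n0 + 1" using False by simp
      also have "\<dots> \<le> (real n0 + 1) * X powr (1 / 2 - c)"
        using X1 mult_left_mono[OF X1, of "real n0 + 1"] by simp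
      finally show ?thesis by (simp add: cardB)
    qed
  qed
  then show ?thesis
    using c(1) by (intro exI[of _ c] conjI exI[of _ "real n0 + 1"]) auto
qed

end
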